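(* Let $n\ge 1$ and let $g$ be the Semi-Riemannian metric on $SL_n=SL_n(\mathbb{R})$ given by $g_A(V,W)=\mathrm{tr}(A^{-1}VA^{-1}W)$ for $A\in SL_n$ and $V,W\in T_A(SL_n)=\{W\in M_n(\mathbb{R}):\mathrm{tr}(A^{-1}W)=0\}$. Then $(SL_n,g)$ is an Einstein Semi-Riemannian manifold with Ricci curvature tensor $Ric=-\frac n2\,g$ and scalar curvature $S=-\frac{(n-1)n(n+1)}{2}$.
   Context: $SL_n(\mathbb{R})$ is the group of real $n\times n$ matrices of determinant $1$. A Semi-Riemannian manifold is Einstein if $Ric$ is a (constant) multiple of the metric. Sign conventions: with $\nabla$ the Levi-Civita connection, $R_{XY}Z=\nabla_{[X,Y]}Z-\nabla_X\nabla_YZ+\nabla_Y\nabla_XZ$; $Ric(X,Y)$ is the trace of the linear map $Z\mapsto R_{XZ}Y$; the scalar curvature is the trace of $Ric$ with respect to $g$. *)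

theory Defs
  imports "HOL-Analysis.Analysis"
begin

section \<open>Smooth functions and embedded submanifolds of Euclidean space\<close>

text \<open>\<open>C_k_on k U f\<close> is meant for open \<open>U\<close> only; there, on a finite-dimensional domain, it is the
  usual notion of a function of class \<open>C\<^sup>k\<close>.\<close>

primrec C_k_on :: "nat \<Rightarrow> 'a::real_normed_vector set \<Rightarrow> ('a \<Rightarrow> 'b::real_normed_vector) \<Rightarrow> bool" where
  "C_k_on 0 U f \<longleftrightarrow> continuous_on U f"
| "C_k_on (Suc k) U f \<longleftrightarrow>
     f differentiable_on U \<and> (\<forall>v. C_k_on k U (\<lambda>x. frechet_derivative f (at x) v))"

definition smooth_on_open :: "'a::real_normed_vector set \<Rightarrow> ('a \<Rightarrow> 'b::real_normed_vector) \<Rightarrow> bool" where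
  "smooth_on_open U f \<longleftrightarrow> open U \<and> (\<forall>k. C_k_on k U f)"

definition smooth_on :: "'a::real_normed_vector set \<Rightarrow> ('a \<Rightarrow> 'b::real_normed_vector) \<Rightarrow> bool" where
  "smooth_on M f \<longleftrightarrow>
     (\<forall>p\<in>M. \<exists>U F. p \<in> U \<and> smooth_on_open U F \<and> (\<forall>q\<in>M \<inter> U. F q = f q))"

definition embedded_submanifold :: "'a::euclidean_space set \<Rightarrow> nat \<Rightarrow> bool" where
  "embedded_submanifold M d \<longleftrightarrow>
     (\<forall>p\<in>M. \<exists>U V \<phi> \<psi> S. p \<in> U \<and> smooth_on_open U \<phi> \<and> smooth_on_open V \<psi> \<and>
        homeomorphism U V \<phi> \<psi> \<and>
        subspace (S :: 'a set) \<and> dim S = d \<and> \<phi> ` (M \<inter> U) = S \<inter> V)"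

definition tangent_space :: "'a::euclidean_space set \<Rightarrow> 'a \<Rightarrow> 'a set" where
  "tangent_space M p =
     {v. \<exists>e>0. \<exists>\<gamma>. smooth_on_open {-e<..<e} \<gamma> \<and> \<gamma> ` {-e<..<e} \<subseteq> M \<and> \<gamma> (0::real) = p \<and>
           (\<gamma> has_vector_derivative v) (at 0)}"

text \<open>Vector fields on \<open>M\<close> are total functions on the ambient space; only their values on \<open>M\<close>
  matter.\<close>

definition vector_field :: "'a::euclidean_space set \<Rightarrow> ('a \<Rightarrow> 'a) \<Rightarrow> bool" where
  "vector_field M X \<longleftrightarrow> smooth_on M X \<and> (\<forall>p\<in>M. X p \<in> tangent_space M p)"

text \<open>The derivative of \<open>f\<close> at \<open>p\<close> in the direction \<open>v\<close>. A derivative \<open>at p within M\<close>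
  is in general not unique as a linear map on the ambient space, but its values on tangent vectors
  are: see \<open>deriv_along_extension\<close> below.\<close>

definition deriv_along :: "'a::euclidean_space set \<Rightarrow> ('a \<Rightarrow> 'b::real_normed_vector) \<Rightarrow> 'a \<Rightarrow> 'a \<Rightarrow> 'b" where
  "deriv_along M f p v = frechet_derivative f (at p within M) v"

lemma derivative_within_tangent_unique:
  assumes v: "v \<in> tangent_space M p"
    and f1: "(f has_derivative f1) (at p within M)" and f2: "(f has_derivative f2) (at p within M)"
  shows "f1 v = f2 v"
proof -
  obtain e \<gamma> where e: "e > 0" and \<gamma>: "\<gamma> ` {-e<..<e} \<subseteq> M" "\<gamma> (0::real) = p"
    and d\<gamma>: "(\<gamma> has_vector_derivative v) (at 0)"
    using v unfolding tangent_space_def by blast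
  have 0: "(0::real) \<in> {-e<..<e}" using e by simp
  have *: "((\<lambda>t. f (\<gamma> t)) has_vector_derivative f' v) (at 0)"
    if f': "(f has_derivative f') (at p within M)" for f'
  proof -
    have "((\<lambda>t. f (\<gamma> t)) has_derivative (\<lambda>t. f' (t *\<^sub>R v))) (at 0 within {-e<..<e})"
      by (rule has_derivative_in_compose[where g = f])
         (use d\<gamma> \<gamma> f' in \<open>auto simp: has_vector_derivative_def
            intro: has_derivative_at_withinI has_derivative_subset\<close>)
    moreover have "f' (t *\<^sub>R v) = t *\<^sub>R f' v" for t
      using f' by (simp add: has_derivative_def bounded_linear.linear linear_cmul)
    ultimately show ?thesis
      using at_within_open[OF 0 open_greaterThanLessThan] by (simp add: has_vector_derivative_def)
  qed
  show ?thesis using vector_derivative_unique_at[OF *[OF f1] *[OF f2]] .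
qed

lemma deriv_along_extension:
  assumes v: "v \<in> tangent_space M p" and U: "open U" "p \<in> U" "p \<in> M"
    and F: "(F has_derivative F') (at p)" and eq: "\<And>q. q \<in> M \<inter> U \<Longrightarrow> F q = f q"
  shows "deriv_along M f p v = F' v"
proof -
  obtain d where d: "d > 0" "ball p d \<subseteq> U" using U openE by blast
  have "(f has_derivative F') (at p within M)"
    by (rule has_derivative_transform_within[OF has_derivative_at_withinI[OF F] d(1) U(3)])
       (use d eq in \<open>auto simp: dist_commute subset_eq\<close>)
  then show ?thesis
    unfolding deriv_along_def
    using derivative_within_tangent_unique[OF v] frechet_derivative_works differentiable_def by blast
qed

definition lie_bracket :: "'a::euclidean_space set \<Rightarrow> ('a \<Rightarrow> 'a) \<Rightarrow> ('a \<Rightarrow> 'a) \<Rightarrow> 'a \<Rightarrow> 'a" where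
  "lie_bracket M X Y p = deriv_along M Y p (X p) - deriv_along M X p (Y p)"


section \<open>Semi-Riemannian metrics and the Levi-Civita connection\<close>

definition nondegenerate_symmetric_form :: "'a::euclidean_space set \<Rightarrow> ('a \<Rightarrow> 'a \<Rightarrow> real) \<Rightarrow> bool" where
  "nondegenerate_symmetric_form T b \<longleftrightarrow>
     (\<forall>x\<in>T. \<forall>y\<in>T. b x y = b y x) \<and>
     (\<forall>x\<in>T. \<forall>y\<in>T. \<forall>z\<in>T. \<forall>r s. b (r *\<^sub>R x + s *\<^sub>R y) z = r * b x z + s * b y z) \<and>
     (\<forall>x\<in>T. (\<forall>y\<in>T. b x y = 0) \<longrightarrow> x = 0)"

definition index_form :: "'a::euclidean_space set \<Rightarrow> ('a \<Rightarrow> 'a \<Rightarrow> real) \<Rightarrow> nat" where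
  "index_form T b = Max {dim S |S. subspace S \<and> S \<subseteq> T \<and> (\<forall>x\<in>S. x \<noteq> 0 \<longrightarrow> b x x < 0)}"

definition semi_riemannian_metric :: "'a::euclidean_space set \<Rightarrow> ('a \<Rightarrow> 'a \<Rightarrow> 'a \<Rightarrow> real) \<Rightarrow> bool" where
  "semi_riemannian_metric M g \<longleftrightarrow>
     (\<forall>p\<in>M. nondegenerate_symmetric_form (tangent_space M p) (g p)) \<and>
     (\<exists>\<nu>. \<forall>p\<in>M. index_form (tangent_space M p) (g p) = \<nu>) \<and>
     (\<forall>X Y. vector_field M X \<longrightarrow> vector_field M Y \<longrightarrow> smooth_on M (\<lambda>p. g p (X p) (Y p)))"

definition semi_riemannian_manifold :: "'a::euclidean_space set \<Rightarrow> ('a \<Rightarrow> 'a \<Rightarrow> 'a \<Rightarrow> real) \<Rightarrow> bool" where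
  "semi_riemannian_manifold M g \<longleftrightarrow> (\<exists>d. embedded_submanifold M d) \<and> semi_riemannian_metric M g"

definition affine_connection ::
    "'a::euclidean_space set \<Rightarrow> (('a \<Rightarrow> 'a) \<Rightarrow> ('a \<Rightarrow> 'a) \<Rightarrow> 'a \<Rightarrow> 'a) \<Rightarrow> bool" where
  "affine_connection M nab \<longleftrightarrow>
     (\<forall>X Y. vector_field M X \<longrightarrow> vector_field M Y \<longrightarrow> vector_field M (nab X Y)) \<and>
     (\<forall>f h X X' Y. smooth_on M f \<longrightarrow> smooth_on M h \<longrightarrow>
        vector_field M X \<longrightarrow> vector_field M X' \<longrightarrow> vector_field M Y \<longrightarrow>
        (\<forall>p\<in>M. nab (\<lambda>q. f q *\<^sub>R X q + h q *\<^sub>R X' q) Y p = f p *\<^sub>R nab X Y p + h p *\<^sub>R nab X' Y p)) \<and>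
     (\<forall>X Y Y'. vector_field M X \<longrightarrow> vector_field M Y \<longrightarrow> vector_field M Y' \<longrightarrow>
        (\<forall>p\<in>M. nab X (\<lambda>q. Y q + Y' q) p = nab X Y p + nab X Y' p)) \<and>
     (\<forall>f X Y. smooth_on M f \<longrightarrow> vector_field M X \<longrightarrow> vector_field M Y \<longrightarrow>
        (\<forall>p\<in>M. nab X (\<lambda>q. f q *\<^sub>R Y q) p = deriv_along M f p (X p) *\<^sub>R Y p + f p *\<^sub>R nab X Y p))"

definition is_levi_civita ::
    "'a::euclidean_space set \<Rightarrow> ('a \<Rightarrow> 'a \<Rightarrow> 'a \<Rightarrow> real) \<Rightarrow>
     (('a \<Rightarrow> 'a) \<Rightarrow> ('a \<Rightarrow> 'a) \<Rightarrow> 'a \<Rightarrow> 'a) \<Rightarrow> bool" where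
  "is_levi_civita M g nab \<longleftrightarrow>
     affine_connection M nab \<and>
     (\<forall>X Y. vector_field M X \<longrightarrow> vector_field M Y \<longrightarrow>
        (\<forall>p\<in>M. nab X Y p - nab Y X p = lie_bracket M X Y p)) \<and>
     (\<forall>X Y Z. vector_field M X \<longrightarrow> vector_field M Y \<longrightarrow> vector_field M Z \<longrightarrow>
        (\<forall>p\<in>M. deriv_along M (\<lambda>q. g q (Y q) (Z q)) p (X p) =
                 g p (nab X Y p) (Z p) + g p (Y p) (nab X Z p)))"

text \<open>The values \<open>nab X Y p\<close> of a Levi-Civita connection are unique for vector fields \<open>X\<close>, \<open>Y\<close>
  and \<open>p \<in> M\<close>, but a total function \<open>nab\<close> is arbitrary elsewhere; hence the choice operator.\<close>

definition levi_civita ::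
    "'a::euclidean_space set \<Rightarrow> ('a \<Rightarrow> 'a \<Rightarrow> 'a \<Rightarrow> real) \<Rightarrow> ('a \<Rightarrow> 'a) \<Rightarrow> ('a \<Rightarrow> 'a) \<Rightarrow> 'a \<Rightarrow> 'a" where
  "levi_civita M g = (SOME nab. is_levi_civita M g nab)"


section \<open>Curvature\<close>

text \<open>The Riemann curvature on vector fields, \<open>R\<^bsub>XY\<^esub>Z\<close>, with the sign
  \<open>\<nabla>\<^bsub>[X,Y]\<^esub>Z - \<nabla>\<^sub>X\<nabla>\<^sub>YZ + \<nabla>\<^sub>Y\<nabla>\<^sub>XZ\<close>.\<close>

definition curvature ::
    "'a::euclidean_space set \<Rightarrow> ('a \<Rightarrow> 'a \<Rightarrow> 'a \<Rightarrow> real) \<Rightarrow>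
     ('a \<Rightarrow> 'a) \<Rightarrow> ('a \<Rightarrow> 'a) \<Rightarrow> ('a \<Rightarrow> 'a) \<Rightarrow> 'a \<Rightarrow> 'a" where
  "curvature M g X Y Z p =
     (let nab = levi_civita M g
      in nab (lie_bracket M X Y) Z p - nab X (nab Y Z) p + nab Y (nab X Z) p)"

text \<open>The curvature tensor at a point: the common value of \<open>R\<^bsub>XY\<^esub>Z\<close> at \<open>p\<close> over all vector fields
  extending the given tangent vectors.\<close>

definition curvature_at ::
    "'a::euclidean_space set \<Rightarrow> ('a \<Rightarrow> 'a \<Rightarrow> 'a \<Rightarrow> real) \<Rightarrow> 'a \<Rightarrow> 'a \<Rightarrow> 'a \<Rightarrow> 'a \<Rightarrow> 'a" where
  "curvature_at M g p x y z =
     (THE r. \<forall>X Y Z. vector_field M X \<longrightarrow> vector_field M Y \<longrightarrow> vector_field M Z \<longrightarrow>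
        X p = x \<longrightarrow> Y p = y \<longrightarrow> Z p = z \<longrightarrow> curvature M g X Y Z p = r)"

text \<open>Trace of a linear endomorphism of a subspace \<open>T\<close>, computed in any basis of \<open>T\<close>.\<close>

definition trace_on :: "'a::euclidean_space set \<Rightarrow> ('a \<Rightarrow> 'a) \<Rightarrow> real" where
  "trace_on T L =
     (let B = (SOME B. independent B \<and> span B = T) in \<Sum>b\<in>B. representation B (L b) b)"

definition ricci ::
    "'a::euclidean_space set \<Rightarrow> ('a \<Rightarrow> 'a \<Rightarrow> 'a \<Rightarrow> real) \<Rightarrow> 'a \<Rightarrow> 'a \<Rightarrow> 'a \<Rightarrow> real" where
  "ricci M g p x y = trace_on (tangent_space M p) (\<lambda>z. curvature_at M g p x z y)"

text \<open>Trace of a bilinear form \<open>b\<close> with respect to a nondegenerate form \<open>g\<close>, i.e. the trace of the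
  endomorphism \<open>L\<close> with \<open>g (L x) y = b x y\<close>.\<close>

definition metric_trace :: "'a::euclidean_space set \<Rightarrow> ('a \<Rightarrow> 'a \<Rightarrow> real) \<Rightarrow> ('a \<Rightarrow> 'a \<Rightarrow> real) \<Rightarrow> real" where
  "metric_trace T g b = trace_on T (\<lambda>x. THE u. u \<in> T \<and> (\<forall>y\<in>T. g u y = b x y))"

definition scalar_curvature ::
    "'a::euclidean_space set \<Rightarrow> ('a \<Rightarrow> 'a \<Rightarrow> 'a \<Rightarrow> real) \<Rightarrow> 'a \<Rightarrow> real" where
  "scalar_curvature M g p = metric_trace (tangent_space M p) (g p) (ricci M g p)"

definition einstein_manifold :: "'a::euclidean_space set \<Rightarrow> ('a \<Rightarrow> 'a \<Rightarrow> 'a \<Rightarrow> real) \<Rightarrow> bool" where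
  "einstein_manifold M g \<longleftrightarrow> semi_riemannian_manifold M g \<and>
     (\<exists>c. \<forall>p\<in>M. \<forall>x\<in>tangent_space M p. \<forall>y\<in>tangent_space M p. ricci M g p x y = c * g p x y)"


section \<open>The special linear group\<close>

definition SL :: "(real^'n^'n) set" where
  "SL = {A. det A = 1}"

definition SL_metric :: "real^'n^'n \<Rightarrow> real^'n^'n \<Rightarrow> real^'n^'n \<Rightarrow> real" where
  "SL_metric A V W = trace (matrix_inv A ** V ** matrix_inv A ** W)"

end

theory Submission
  imports Defs
begin

text \<open>The connection \<open>\<nabla>\<^sub>XY = dY(X) - \<onehalf>(X A\<^sup>-\<^sup>1 Y + Y A\<^sup>-\<^sup>1 X)\<close> preserves tangency to \<open>SL\<close>, is torsion free and
  metric, hence is the Levi-Civita connection. The second derivatives cancel in the curvature, leaving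
  \<open>R\<^sub>x\<^sub>zy = \<onequarter> A[[a,c],b]\<close> where \<open>a, b, c\<close> are the left translates of \<open>x, y, z\<close> to the identity.
  As a function of \<open>z\<close> this makes sense for every matrix and has tangent values, so its trace may be
  computed on all matrices, where \<open>z \<mapsto> u z v\<close> has trace \<open>tr u tr v\<close>; as \<open>tr a = tr b = 0\<close>, what
  remains is \<open>- n/2 tr(ab)\<close>.\<close>

section \<open>Smooth functions\<close>

text \<open>What shapes the proof is that the definitions speak of arbitrary vector fields.
  \<open>levi_civita\<close> is a choice, so the explicit connection may replace it only after
  uniqueness is known, and then only for vector fields and at points of \<open>SL\<close>.
  \<open>curvature_at\<close> asks for one value common to all extensions of three tangent vectors;
  evaluating on left-invariant fields, where the connection is half the commutator, therefore does
  not suffice. The curvature is computed for arbitrary fields, which brings in second derivatives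
  and Clairaut's theorem; that only point values survive is at the same time the proof that the
  curvature is a tensor. The correction in the connection comes from the two inverses in the metric:
  sharing their derivatives equally between the two arguments of the metric gives the factor one
  half. In the Ricci trace two of the four terms of the double commutator contribute
  \<open>- n tr(ab)\<close> each, whence \<open>(1/4) (- 2 n) = - n/2\<close>.\<close>

lemma C_k_on_cong:
  assumes "open U" "\<And>x. x \<in> U \<Longrightarrow> f x = g x"
  shows "C_k_on k U f \<longleftrightarrow> C_k_on k U g"
  using assms(2)
proof (induction k arbitrary: f g)
  case 0
  then show ?case by (simp cong: continuous_on_cong)
next
  case (Suc k)
  have diff: "f differentiable_on U \<longleftrightarrow> g differentiable_on U"
    using Suc.prems has_derivative_transform[of _ U f g] has_derivative_transform[of _ U g f]
    unfolding differentiable_on_def differentiable_def by metis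
  show ?case
  proof (cases "f differentiable_on U")
    case True
    have "frechet_derivative f (at x) = frechet_derivative g (at x)" if "x \<in> U" for x
      using True that assms(1) Suc.prems
      by (intro frechet_derivative_transform_within_open[of f x U])
        (auto simp: differentiable_on_eq_differentiable_at)
    then have "C_k_on k U (\<lambda>x. frechet_derivative f (at x) v) \<longleftrightarrow>
        C_k_on k U (\<lambda>x. frechet_derivative g (at x) v)" for v
      by (intro Suc.IH) simp
    with diff show ?thesis by simp
  qed (use diff in simp)
qed

lemma C_k_on_SucD: "C_k_on (Suc k) U f \<Longrightarrow> C_k_on k U f"
proof (induction k arbitrary: f)
  case 0
  then show ?case by (simp add: differentiable_imp_continuous_on)
next
  case (Suc k)
  have "f differentiable_on U" "C_k_on (Suc k) U (\<lambda>x. frechet_derivative f (at x) v)" for v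
    using Suc.prems by simp_all
  then show ?case using Suc.IH by (simp only: C_k_on.simps(2)) blast
qed

lemma C_k_on_subset:
  assumes "C_k_on k U f" "V \<subseteq> U"
  shows "C_k_on k V f"
  using assms(1)
  by (induction k arbitrary: f)
    (use assms(2) in \<open>auto intro: continuous_on_subset differentiable_on_subset\<close>)

lemma C_k_on_SucI:
  assumes "open U" "\<And>x. x \<in> U \<Longrightarrow> (f has_derivative f' x) (at x)"
    and "\<And>v. C_k_on k U (\<lambda>x. f' x v)"
  shows "C_k_on (Suc k) U f"
proof -
  have "frechet_derivative f (at x) = f' x" if "x \<in> U" for x
    using assms(2)[OF that] by (metis frechet_derivative_at)
  then have "C_k_on k U (\<lambda>x. frechet_derivative f (at x) v)" for v
    using assms(3)[of v] C_k_on_cong[OF assms(1), of "\<lambda>x. frechet_derivative f (at x) v" "\<lambda>x. f' x v"]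
    by simp
  then show ?thesis
    using assms(2) by (auto simp: differentiable_on_def differentiable_def
        intro: has_derivative_at_withinI)
qed

lemma C_k_on_Suc_has_derivative:
  assumes "open U" "C_k_on (Suc k) U f" "x \<in> U"
  shows "(f has_derivative frechet_derivative f (at x)) (at x)"
  using assms by (simp add: differentiable_on_eq_differentiable_at frechet_derivative_works)

lemma C_k_on_const: "open U \<Longrightarrow> C_k_on k U (\<lambda>x. c)"
  by (induction k arbitrary: c) (auto simp: differentiable_on_def)

lemma C_k_on_bounded_linear:
  assumes "open U" "bounded_linear f"
  shows "C_k_on k U f"
proof (cases k)
  case 0
  then show ?thesis using assms(2) by (simp add: linear_continuous_on)
next
  case (Suc m)
  have "C_k_on (Suc m) U f"
    by (rule C_k_on_SucI[where f' = "\<lambda>x. f"])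
      (use assms in \<open>auto intro: bounded_linear_imp_has_derivative C_k_on_const\<close>)
  with Suc show ?thesis by simp
qed

lemma C_k_on_linear_compose:
  assumes "open U" "bounded_linear L" "C_k_on k U f"
  shows "C_k_on k U (\<lambda>x. L (f x))"
  using assms(3)
proof (induction k arbitrary: f)
  case 0
  then show ?case
    using assms(2) by (simp add: bounded_linear.continuous_on)
next
  case (Suc k)
  show ?case
  proof (rule C_k_on_SucI[where f' = "\<lambda>x v. L (frechet_derivative f (at x) v)"])
    fix x assume "x \<in> U"
    then show "((\<lambda>x. L (f x)) has_derivative (\<lambda>v. L (frechet_derivative f (at x) v))) (at x)"
      using bounded_linear.has_derivative[OF assms(2)] C_k_on_Suc_has_derivative[OF assms(1) Suc.prems]
      by blast
  qed (use Suc assms in auto)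
qed

lemma C_k_on_add:
  assumes "open U" "C_k_on k U f" "C_k_on k U g"
  shows "C_k_on k U (\<lambda>x. f x + g x)"
  using assms(2,3)
proof (induction k arbitrary: f g)
  case 0
  then show ?case by (simp add: continuous_on_add)
next
  case (Suc k)
  show ?case
  proof (rule C_k_on_SucI[where f' = "\<lambda>x v. frechet_derivative f (at x) v + frechet_derivative g (at x) v"])
    fix x assume "x \<in> U"
    then show "((\<lambda>x. f x + g x) has_derivative
        (\<lambda>v. frechet_derivative f (at x) v + frechet_derivative g (at x) v)) (at x)"
      using C_k_on_Suc_has_derivative[OF assms(1)] Suc.prems by (intro has_derivative_add) blast+
  qed (use Suc assms in auto)
qed

text \<open>The product rule writes a directional derivative as a sum of two products of the same
  kind, and the factor that is not differentiated has class \<open>k\<close> by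
  \<open>C_k_on_SucD\<close>; so the induction closes. Multiplication, scaling and matrix
  multiplication are instances.\<close>

lemma C_k_on_bilinear:
  assumes "bounded_bilinear h" "open U" "C_k_on k U f" "C_k_on k U g"
  shows "C_k_on k U (\<lambda>x. h (f x) (g x))"
  using assms(3,4)
proof (induction k arbitrary: f g)
  case 0
  then show ?case using assms(1) by (simp add: bounded_bilinear.continuous_on)
next
  case (Suc k)
  show ?case
  proof (rule C_k_on_SucI[where f' = "\<lambda>x v. h (f x) (frechet_derivative g (at x) v) +
      h (frechet_derivative f (at x) v) (g x)"])
    fix x assume "x \<in> U"
    then show "((\<lambda>x. h (f x) (g x)) has_derivative (\<lambda>v. h (f x) (frechet_derivative g (at x) v) +
      h (frechet_derivative f (at x) v) (g x))) (at x)"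
      using C_k_on_Suc_has_derivative[OF assms(2) Suc.prems(1)] C_k_on_Suc_has_derivative[OF assms(2) Suc.prems(2)]
      by (intro bounded_bilinear.FDERIV[OF assms(1)])
  next
    fix v
    show "C_k_on k U (\<lambda>x. h (f x) (frechet_derivative g (at x) v) + h (frechet_derivative f (at x) v) (g x))"
      using Suc.prems Suc.prems[THEN C_k_on_SucD] by (intro C_k_on_add assms(2) Suc.IH) simp_all
  qed (rule assms(2))
qed

lemma smooth_on_open_open: "smooth_on_open U f \<Longrightarrow> open U"
  by (simp add: smooth_on_open_def)

lemma smooth_on_open_subset:
  "smooth_on_open U f \<Longrightarrow> open V \<Longrightarrow> V \<subseteq> U \<Longrightarrow> smooth_on_open V f"
  unfolding smooth_on_open_def using C_k_on_subset by blast

lemma smooth_on_open_cong: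
  "(\<And>x. x \<in> U \<Longrightarrow> f x = g x) \<Longrightarrow> smooth_on_open U f \<longleftrightarrow> smooth_on_open U g"
  unfolding smooth_on_open_def using C_k_on_cong by blast

lemma smooth_on_open_const: "open U \<Longrightarrow> smooth_on_open U (\<lambda>x. c)"
  by (simp add: smooth_on_open_def C_k_on_const)

lemma smooth_on_open_bounded_linear: "open U \<Longrightarrow> bounded_linear f \<Longrightarrow> smooth_on_open U f"
  by (simp add: smooth_on_open_def C_k_on_bounded_linear)

lemma smooth_on_open_linear_compose:
  "bounded_linear L \<Longrightarrow> smooth_on_open U f \<Longrightarrow> smooth_on_open U (\<lambda>x. L (f x))"
  by (simp add: smooth_on_open_def C_k_on_linear_compose)

lemma smooth_on_open_add:
  "smooth_on_open U f \<Longrightarrow> smooth_on_open U g \<Longrightarrow> smooth_on_open U (\<lambda>x. f x + g x)"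
  by (simp add: smooth_on_open_def C_k_on_add)

lemma smooth_on_open_diff:
  "smooth_on_open U f \<Longrightarrow> smooth_on_open U g \<Longrightarrow> smooth_on_open U (\<lambda>x. f x - g x)"
  using smooth_on_open_add[of U f "\<lambda>x. - g x"]
    smooth_on_open_linear_compose[OF bounded_linear_minus[OF bounded_linear_ident], of U g]
  by simp

lemma smooth_on_open_bilinear:
  "bounded_bilinear h \<Longrightarrow> smooth_on_open U f \<Longrightarrow> smooth_on_open U g \<Longrightarrow>
   smooth_on_open U (\<lambda>x. h (f x) (g x))"
  by (simp add: smooth_on_open_def C_k_on_bilinear)

lemmas smooth_on_open_mult = smooth_on_open_bilinear[OF bounded_bilinear_mult]
lemmas smooth_on_open_scaleR = smooth_on_open_bilinear[OF bounded_bilinear_scaleR]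

lemma smooth_on_open_sum:
  assumes "open U" "\<And>i. i \<in> I \<Longrightarrow> smooth_on_open U (f i)"
  shows "smooth_on_open U (\<lambda>x. \<Sum>i\<in>I. f i x)"
  using assms(2)
  by (induction I rule: infinite_finite_induct)
    (simp_all add: smooth_on_open_const smooth_on_open_add assms(1))

lemma smooth_on_open_prod:
  fixes f :: "'i \<Rightarrow> 'a::real_normed_vector \<Rightarrow> 'b::{real_normed_algebra,comm_ring_1}"
  assumes "open U" "\<And>i. i \<in> I \<Longrightarrow> smooth_on_open U (f i)"
  shows "smooth_on_open U (\<lambda>x. \<Prod>i\<in>I. f i x)"
  using assms(2)
  by (induction I rule: infinite_finite_induct)
    (simp_all add: smooth_on_open_const smooth_on_open_mult assms(1))

lemma smooth_on_open_inverse: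
  fixes f :: "'a::real_normed_vector \<Rightarrow> real"
  assumes "smooth_on_open U f" "\<And>x. x \<in> U \<Longrightarrow> f x \<noteq> 0"
  shows "smooth_on_open U (\<lambda>x. inverse (f x))"
proof -
  have U: "open U" and f: "\<And>k. C_k_on k U f"
    using assms(1) by (auto simp: smooth_on_open_def)
  have "C_k_on k U (\<lambda>x. inverse (f x))" for k
  proof (induction k)
    case 0
    show ?case
      using continuous_on_inverse[of U f] f[of 0] assms(2) by fastforce
  next
    case (Suc k)
    show ?case
    \<comment> \<open>The derivative is written with \<open>inverse (f x)\<close> itself as a
      factor: the induction hypothesis gives this factor class \<open>k\<close>, and
      \<open>C_k_on_bilinear\<close> handles the products.\<close>
    proof (rule C_k_on_SucI[OF U, where f' = "\<lambda>x v. (- 1 * frechet_derivative f (at x) v) *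
        (inverse (f x) * inverse (f x))"])
      fix x assume x: "x \<in> U"
      show "((\<lambda>x. inverse (f x)) has_derivative
          (\<lambda>v. (- 1 * frechet_derivative f (at x) v) * (inverse (f x) * inverse (f x)))) (at x)"
        by (rule has_derivative_eq_rhs[OF Deriv.has_derivative_inverse[OF assms(2)[OF x]
              C_k_on_Suc_has_derivative[OF U f x]]]) (simp add: mult_ac)
    next
      fix v
      show "C_k_on k U (\<lambda>x. (- 1 * frechet_derivative f (at x) v) * (inverse (f x) * inverse (f x)))"
        using f[of "Suc k"] by (intro C_k_on_bilinear[OF bounded_bilinear_mult] U Suc C_k_on_const) simp
    qed
  qed
  with U show ?thesis by (simp add: smooth_on_open_def)
qed

lemma smooth_on_open_has_derivative:
  "smooth_on_open U f \<Longrightarrow> x \<in> U \<Longrightarrow> (f has_derivative frechet_derivative f (at x)) (at x)"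
  using C_k_on_Suc_has_derivative smooth_on_open_def by blast

lemma smooth_on_open_frechet_derivative:
  assumes "smooth_on_open U f"
  shows "smooth_on_open U (\<lambda>x. frechet_derivative f (at x) v)"
proof -
  have "C_k_on (Suc k) U f" for k
    using assms unfolding smooth_on_open_def by blast
  then show ?thesis
    using smooth_on_open_open[OF assms] by (simp add: smooth_on_open_def)
qed

text \<open>\<open>C_k_on\<close> controls derivatives in a fixed direction only. Expanding the
  varying direction \<open>G x\<close> in the standard basis reduces to those, with smooth
  coefficients.\<close>

lemma smooth_on_open_frechet_derivative_field:
  fixes G :: "'a::euclidean_space \<Rightarrow> 'a"
  assumes F: "smooth_on_open U F" and G: "smooth_on_open U G"
  shows "smooth_on_open U (\<lambda>x. frechet_derivative F (at x) (G x))"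
proof -
  have "frechet_derivative F (at x) (G x) = (\<Sum>b\<in>Basis. (G x \<bullet> b) *\<^sub>R frechet_derivative F (at x) b)"
    if "x \<in> U" for x
  proof -
    have "linear (frechet_derivative F (at x))"
      using smooth_on_open_has_derivative[OF F that] has_derivative_linear by blast
    then have "frechet_derivative F (at x) (\<Sum>b\<in>Basis. (G x \<bullet> b) *\<^sub>R b) =
        (\<Sum>b\<in>Basis. (G x \<bullet> b) *\<^sub>R frechet_derivative F (at x) b)"
      by (simp add: linear_sum linear_cmul)
    then show ?thesis by (simp add: euclidean_representation)
  qed
  moreover have "smooth_on_open U (\<lambda>x. \<Sum>b\<in>Basis. (G x \<bullet> b) *\<^sub>R frechet_derivative F (at x) b)"
    by (intro smooth_on_open_sum smooth_on_open_scaleR smooth_on_open_frechet_derivative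
        smooth_on_open_linear_compose[OF bounded_linear_inner_left] F G smooth_on_open_open[OF F])
  ultimately show ?thesis by (simp cong: smooth_on_open_cong)
qed

text \<open>Clairaut's theorem. The second difference of \<open>f\<close> at \<open>p\<close> with steps \<open>h v\<close> and \<open>h w\<close>,
  divided by \<open>h\<^sup>2\<close>, is by two applications of the mean value theorem a value of the mixed second
  derivative near \<open>p\<close>; by continuity it tends to both mixed derivatives at \<open>p\<close>.\<close>

lemma second_difference_mean_value:
  fixes f :: "'a::real_normed_vector \<Rightarrow> real"
  assumes f: "smooth_on_open U f" and h: "0 < h"
    and box: "\<And>s t. \<lbrakk>0 \<le> s; s \<le> h; 0 \<le> t; t \<le> h\<rbrakk> \<Longrightarrow> p + s *\<^sub>R v + t *\<^sub>R w \<in> U"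
  shows "\<exists>s\<in>{0<..<h}. \<exists>t\<in>{0<..<h}.
    f (p + h *\<^sub>R v + h *\<^sub>R w) - f (p + h *\<^sub>R v) - f (p + h *\<^sub>R w) + f p =
    h * (h * frechet_derivative (\<lambda>q. frechet_derivative f (at q) v) (at (p + s *\<^sub>R v + t *\<^sub>R w)) w)"
proof -
  define D where "D = (\<lambda>q. frechet_derivative f (at q))"
  define K where "K = (\<lambda>q. D q v)"
  have K: "smooth_on_open U K"
    unfolding K_def D_def by (rule smooth_on_open_frechet_derivative[OF f])
  have D: "(f has_derivative D q) (at q)" if "q \<in> U" for q
    using smooth_on_open_has_derivative[OF f that] by (simp add: D_def)
  have line: "((\<lambda>s. F (a + s *\<^sub>R u)) has_derivative (\<lambda>r. r * F' u)) (at s within S)"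
    if "(F has_derivative F') (at (a + s *\<^sub>R u))" for F :: "'a \<Rightarrow> real" and F' a u s S
  proof -
    have "((\<lambda>s. F (a + s *\<^sub>R u)) has_derivative (\<lambda>r. F' (r *\<^sub>R u))) (at s within S)"
      by (rule has_derivative_compose[of "\<lambda>s. a + s *\<^sub>R u" "\<lambda>r. r *\<^sub>R u" s S F F'])
        (auto intro!: derivative_eq_intros that)
    then show ?thesis
      using has_derivative_linear[OF that] by (simp add: linear_cmul)
  qed
  have "\<exists>s\<in>{0<..<h}. (\<lambda>s. f ((p + h *\<^sub>R w) + s *\<^sub>R v) - f (p + s *\<^sub>R v)) h -
      (\<lambda>s. f ((p + h *\<^sub>R w) + s *\<^sub>R v) - f (p + s *\<^sub>R v)) 0 =
      (\<lambda>r. r * D ((p + h *\<^sub>R w) + s *\<^sub>R v) v - r * D (p + s *\<^sub>R v) v) (h - 0)"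
  proof (rule mvt_simple[OF h])
    fix s assume "0 \<le> s" "s \<le> h"
    then have "(p + h *\<^sub>R w) + s *\<^sub>R v \<in> U" "p + s *\<^sub>R v \<in> U"
      using box[of s h] box[of s 0] h by (simp_all add: add_ac)
    then show "((\<lambda>s. f ((p + h *\<^sub>R w) + s *\<^sub>R v) - f (p + s *\<^sub>R v)) has_derivative
        (\<lambda>r. r * D ((p + h *\<^sub>R w) + s *\<^sub>R v) v - r * D (p + s *\<^sub>R v) v)) (at s within {0..h})"
      using line[OF D] by (intro has_derivative_diff)
  qed
  then obtain s where s: "s \<in> {0<..<h}" and
    1: "f (p + h *\<^sub>R v + h *\<^sub>R w) - f (p + h *\<^sub>R v) - f (p + h *\<^sub>R w) + f p =
      h * (K (p + s *\<^sub>R v + h *\<^sub>R w) - K (p + s *\<^sub>R v))"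
    by (auto simp: K_def algebra_simps)
  have "\<exists>t\<in>{0<..<h}. K (p + s *\<^sub>R v + h *\<^sub>R w) - K (p + s *\<^sub>R v + 0 *\<^sub>R w) =
      (\<lambda>r. r * frechet_derivative K (at (p + s *\<^sub>R v + t *\<^sub>R w)) w) (h - 0)"
  proof (rule mvt_simple[OF h, where f = "\<lambda>t. K (p + s *\<^sub>R v + t *\<^sub>R w)"])
    fix t assume "0 \<le> t" "t \<le> h"
    then have "p + s *\<^sub>R v + t *\<^sub>R w \<in> U"
      using box[of s t] s by simp
    then show "((\<lambda>t. K (p + s *\<^sub>R v + t *\<^sub>R w)) has_derivative
        (\<lambda>r. r * frechet_derivative K (at (p + s *\<^sub>R v + t *\<^sub>R w)) w)) (at t within {0..h})"
      by (intro line smooth_on_open_has_derivative[OF K])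
  qed
  then obtain t where "t \<in> {0<..<h}" "K (p + s *\<^sub>R v + h *\<^sub>R w) - K (p + s *\<^sub>R v) =
      h * frechet_derivative K (at (p + s *\<^sub>R v + t *\<^sub>R w)) w"
    by auto
  with s 1 show ?thesis
    unfolding K_def D_def by metis
qed

lemma second_derivative_symmetric_real:
  fixes f :: "'a::real_normed_vector \<Rightarrow> real"
  assumes f: "smooth_on_open U f" and p: "p \<in> U"
  shows "frechet_derivative (\<lambda>q. frechet_derivative f (at q) v) (at p) w =
    frechet_derivative (\<lambda>q. frechet_derivative f (at q) w) (at p) v"
proof -
  define H where "H = (\<lambda>v w q. frechet_derivative (\<lambda>q. frechet_derivative f (at q) v) (at q) w)"
  have cont: "isCont (H v w) p" for v w
  proof -
    have "smooth_on_open U (H v w)"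
      unfolding H_def by (intro smooth_on_open_frechet_derivative f)
    then have "C_k_on 0 U (H v w)" "open U" unfolding smooth_on_open_def by blast+
    then show ?thesis using p by (simp add: continuous_on_eq_continuous_at)
  qed
  have "\<bar>H v w p - H w v p\<bar> \<le> e" if e: "e > 0" for e
  proof -
    obtain d1 where d1: "d1 > 0" "\<And>q. dist q p < d1 \<Longrightarrow> \<bar>H v w q - H v w p\<bar> < e / 2"
      using cont[of v w] e unfolding continuous_at_eps_delta dist_real_def
      by (meson half_gt_zero)
    obtain d2 where d2: "d2 > 0" "\<And>q. dist q p < d2 \<Longrightarrow> \<bar>H w v q - H w v p\<bar> < e / 2"
      using cont[of w v] e unfolding continuous_at_eps_delta dist_real_def
      by (meson half_gt_zero)
    obtain d3 where d3: "d3 > 0" "ball p d3 \<subseteq> U"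
      using p smooth_on_open_open[OF f] openE by blast
    define d where "d = min d1 (min d2 d3)"
    \<comment> \<open>All points of the parallelogram have distance at most
      \<open>h * (norm v + norm w)\<close> from \<open>p\<close>, so this choice keeps them within
      \<open>d / 2\<close>; the summand 1 covers \<open>v = w = 0\<close>.\<close>
    define h where "h = d / (2 * (norm v + norm w + 1))"
    have d: "d > 0" using d1 d2 d3 by (simp add: d_def)
    have nn: "norm v + norm w + 1 > 0" by (simp add: add_nonneg_pos)
    have h: "h > 0" using d nn by (simp add: h_def)
    have near: "dist (p + s *\<^sub>R v + t *\<^sub>R w) p < d" if "0 \<le> s" "s \<le> h" "0 \<le> t" "t \<le> h" for s t
    proof -
      have "dist (p + s *\<^sub>R v + t *\<^sub>R w) p = norm (s *\<^sub>R v + t *\<^sub>R w)"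
        by (simp add: dist_norm)
      also have "\<dots> \<le> s * norm v + t * norm w"
        using norm_triangle_ineq[of "s *\<^sub>R v" "t *\<^sub>R w"] that by simp
      also have "\<dots> \<le> h * norm v + h * norm w"
        using that by (intro add_mono mult_right_mono) auto
      also have "\<dots> \<le> h * (norm v + norm w + 1)"
        using h by (simp add: algebra_simps)
      also have "\<dots> = d / 2" using nn unfolding h_def by (simp add: nonzero_divide_eq_eq)
      finally show ?thesis using d by simp
    qed
    have U: "p + s *\<^sub>R v + t *\<^sub>R w \<in> U" if "0 \<le> s" "s \<le> h" "0 \<le> t" "t \<le> h" for s t
      using near[OF that] d3(2) by (auto simp: d_def dist_commute subset_eq)
    obtain s t where st: "s \<in> {0<..<h}" "t \<in> {0<..<h}"
      "f (p + h *\<^sub>R v + h *\<^sub>R w) - f (p + h *\<^sub>R v) - f (p + h *\<^sub>R w) + f p =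
        h * (h * H v w (p + s *\<^sub>R v + t *\<^sub>R w))"
      using second_difference_mean_value[OF f h U] unfolding H_def by blast
    have U': "p + s *\<^sub>R w + t *\<^sub>R v \<in> U" if "0 \<le> s" "s \<le> h" "0 \<le> t" "t \<le> h" for s t
      using U[of t s] that by (simp add: add_ac)
    obtain s' t' where st': "s' \<in> {0<..<h}" "t' \<in> {0<..<h}"
      "f (p + h *\<^sub>R w + h *\<^sub>R v) - f (p + h *\<^sub>R w) - f (p + h *\<^sub>R v) + f p =
        h * (h * H w v (p + s' *\<^sub>R w + t' *\<^sub>R v))"
      using second_difference_mean_value[OF f h U'] unfolding H_def by blast
    \<comment> \<open>The second difference is unchanged when \<open>v\<close> and \<open>w\<close>
      are exchanged, so the two mixed derivatives agree at their respective intermediate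
      points.\<close>
    have "p + h *\<^sub>R w + h *\<^sub>R v = p + h *\<^sub>R v + h *\<^sub>R w" by (simp add: add_ac)
    then have "h * (h * H v w (p + s *\<^sub>R v + t *\<^sub>R w)) = h * (h * H w v (p + s' *\<^sub>R w + t' *\<^sub>R v))"
      using st(3) st'(3) unfolding \<open>p + h *\<^sub>R w + h *\<^sub>R v = p + h *\<^sub>R v + h *\<^sub>R w\<close> by linarith
    then have eq: "H v w (p + s *\<^sub>R v + t *\<^sub>R w) = H w v (p + s' *\<^sub>R w + t' *\<^sub>R v)"
      using h by simp
    have "\<bar>H v w (p + s *\<^sub>R v + t *\<^sub>R w) - H v w p\<bar> < e / 2"
      using near[of s t] st by (intro d1(2)) (simp add: d_def)
    moreover have "\<bar>H w v (p + s' *\<^sub>R w + t' *\<^sub>R v) - H w v p\<bar> < e / 2"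
      using near[of t' s'] st' by (intro d2(2)) (simp add: d_def add_ac)
    ultimately show ?thesis using eq by linarith
  qed
  then have "\<bar>H v w p - H w v p\<bar> \<le> 0" by (rule field_le_epsilon) simp
  then show ?thesis by (simp add: H_def)
qed

lemma second_derivative_symmetric:
  fixes f :: "'a::real_normed_vector \<Rightarrow> 'b::euclidean_space"
  assumes f: "smooth_on_open U f" and p: "p \<in> U"
  shows "frechet_derivative (\<lambda>q. frechet_derivative f (at q) v) (at p) w =
    frechet_derivative (\<lambda>q. frechet_derivative f (at q) w) (at p) v"
proof (rule euclidean_eqI)
  fix b :: 'b
  have inner: "frechet_derivative (\<lambda>q. F q \<bullet> b) (at q) = (\<lambda>v. frechet_derivative F (at q) v \<bullet> b)"
    if "smooth_on_open U F" "q \<in> U" for F :: "'a \<Rightarrow> 'b" and q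
    using bounded_linear.has_derivative[OF bounded_linear_inner_left smooth_on_open_has_derivative[OF that]]
    by (metis frechet_derivative_at)
  have "frechet_derivative (\<lambda>q. frechet_derivative (\<lambda>q. f q \<bullet> b) (at q) v) (at p) w =
      frechet_derivative (\<lambda>q. frechet_derivative f (at q) v) (at p) w \<bullet> b" for v w
  proof -
    have "smooth_on_open U (\<lambda>q. frechet_derivative f (at q) v \<bullet> b)"
      by (intro smooth_on_open_linear_compose[OF bounded_linear_inner_left]
          smooth_on_open_frechet_derivative f)
    then have "frechet_derivative (\<lambda>q. frechet_derivative f (at q) v \<bullet> b) (at p) =
        frechet_derivative (\<lambda>q. frechet_derivative (\<lambda>q. f q \<bullet> b) (at q) v) (at p)"
      using smooth_on_open_open[OF f] p inner[OF f]
      by (intro frechet_derivative_transform_within_open[where X = U])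
        (auto simp: differentiable_def dest: smooth_on_open_has_derivative)
    then show ?thesis
      using inner[OF smooth_on_open_frechet_derivative[OF f] p] by metis
  qed
  then show "frechet_derivative (\<lambda>q. frechet_derivative f (at q) v) (at p) w \<bullet> b =
      frechet_derivative (\<lambda>q. frechet_derivative f (at q) w) (at p) v \<bullet> b"
    using second_derivative_symmetric_real[OF smooth_on_open_linear_compose[OF bounded_linear_inner_left f] p]
    by metis
qed

section \<open>Calculus along a submanifold\<close>

lemma smooth_on_cong: "(\<And>p. p \<in> M \<Longrightarrow> f p = g p) \<Longrightarrow> smooth_on M f \<longleftrightarrow> smooth_on M g"
  unfolding smooth_on_def by (intro ball_cong ex_cong1 conj_cong refl) simp

lemma smooth_on_open_imp_smooth_on: "smooth_on_open U f \<Longrightarrow> M \<subseteq> U \<Longrightarrow> smooth_on M f"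
  unfolding smooth_on_def by blast

lemma smooth_on_const: "smooth_on M (\<lambda>x. c)"
  by (rule smooth_on_open_imp_smooth_on[OF smooth_on_open_const[OF open_UNIV]]) simp

lemma smooth_on_bounded_linear: "bounded_linear f \<Longrightarrow> smooth_on M f"
  by (rule smooth_on_open_imp_smooth_on[OF smooth_on_open_bounded_linear[OF open_UNIV]]) simp_all

lemma smooth_onE:
  assumes "smooth_on M f" "p \<in> M"
  obtains U F where "p \<in> U" "smooth_on_open U F" "\<And>q. q \<in> M \<inter> U \<Longrightarrow> F q = f q"
proof -
  from assms obtain U F where "p \<in> U" "smooth_on_open U F" "\<forall>q\<in>M \<inter> U. F q = f q"
    unfolding smooth_on_def by blast
  then show thesis by (intro that[of U F]) auto
qed

lemma smooth_onE2:
  assumes "smooth_on M f" "smooth_on M g" "p \<in> M"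
  obtains U F G where "p \<in> U" "smooth_on_open U F" "smooth_on_open U G"
    "\<And>q. q \<in> M \<inter> U \<Longrightarrow> F q = f q" "\<And>q. q \<in> M \<inter> U \<Longrightarrow> G q = g q"
proof -
  obtain U F where F: "p \<in> U" "smooth_on_open U F" "\<And>q. q \<in> M \<inter> U \<Longrightarrow> F q = f q"
    using smooth_onE[OF assms(1,3)] by metis
  obtain V G where G: "p \<in> V" "smooth_on_open V G" "\<And>q. q \<in> M \<inter> V \<Longrightarrow> G q = g q"
    using smooth_onE[OF assms(2,3)] by metis
  have o: "open (U \<inter> V)" using F(2) G(2) by (simp add: smooth_on_open_open open_Int)
  show thesis
    by (rule that[of "U \<inter> V" F G])
      (use F G o in \<open>auto intro: smooth_on_open_subset\<close>)
qed

lemma smooth_on_linear_compose: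
  assumes "bounded_linear L" "smooth_on M f"
  shows "smooth_on M (\<lambda>x. L (f x))"
  unfolding smooth_on_def
proof
  fix p assume "p \<in> M"
  then obtain U F where "p \<in> U" "smooth_on_open U F" "\<And>q. q \<in> M \<inter> U \<Longrightarrow> F q = f q"
    using smooth_onE[OF assms(2)] by metis
  then show "\<exists>U F. p \<in> U \<and> smooth_on_open U F \<and> (\<forall>q\<in>M \<inter> U. F q = L (f q))"
    using smooth_on_open_linear_compose[OF assms(1)]
    by (intro exI[of _ U] exI[of _ "\<lambda>x. L (F x)"]) simp
qed

lemma smooth_on_add:
  assumes "smooth_on M f" "smooth_on M g"
  shows "smooth_on M (\<lambda>x. f x + g x)"
  unfolding smooth_on_def
proof
  fix p assume "p \<in> M"
  from smooth_onE2[OF assms this] obtain U F G where "p \<in> U" "smooth_on_open U F" "smooth_on_open U G"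
    "\<And>q. q \<in> M \<inter> U \<Longrightarrow> F q = f q" "\<And>q. q \<in> M \<inter> U \<Longrightarrow> G q = g q"
    by metis
  then show "\<exists>U F. p \<in> U \<and> smooth_on_open U F \<and> (\<forall>q\<in>M \<inter> U. F q = f q + g q)"
    by (intro exI[of _ U] exI[of _ "\<lambda>x. F x + G x"]) (simp add: smooth_on_open_add)
qed

lemma smooth_on_bilinear:
  assumes "bounded_bilinear h" "smooth_on M f" "smooth_on M g"
  shows "smooth_on M (\<lambda>x. h (f x) (g x))"
  unfolding smooth_on_def
proof
  fix p assume "p \<in> M"
  from smooth_onE2[OF assms(2,3) this] obtain U F G where "p \<in> U" "smooth_on_open U F" "smooth_on_open U G"
    "\<And>q. q \<in> M \<inter> U \<Longrightarrow> F q = f q" "\<And>q. q \<in> M \<inter> U \<Longrightarrow> G q = g q"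
    by metis
  then show "\<exists>U F. p \<in> U \<and> smooth_on_open U F \<and> (\<forall>q\<in>M \<inter> U. F q = h (f q) (g q))"
    by (intro exI[of _ U] exI[of _ "\<lambda>x. h (F x) (G x)"]) (simp add: smooth_on_open_bilinear[OF assms(1)])
qed

lemmas smooth_on_scaleR = smooth_on_bilinear[OF bounded_bilinear_scaleR]

lemma smooth_on_diff: "smooth_on M f \<Longrightarrow> smooth_on M g \<Longrightarrow> smooth_on M (\<lambda>x. f x - g x)"
  using smooth_on_add[of M f "\<lambda>x. - g x"]
    smooth_on_linear_compose[OF bounded_linear_minus[OF bounded_linear_ident], of M g]
  by simp

text \<open>A local smooth extension supplies some derivative within \<open>M\<close>, so the choice
  inside \<open>deriv_along\<close> really is a derivative and in particular linear; its values on
  non-tangent vectors may depend on the choice.\<close>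

lemma has_derivative_deriv_along:
  assumes "smooth_on M f" "p \<in> M"
  shows "(f has_derivative deriv_along M f p) (at p within M)"
proof -
  obtain U F where F: "p \<in> U" "smooth_on_open U F" "\<And>q. q \<in> M \<inter> U \<Longrightarrow> F q = f q"
    using smooth_onE[OF assms] by metis
  obtain d where d: "d > 0" "ball p d \<subseteq> U"
    using F(1) smooth_on_open_open[OF F(2)] openE by blast
  have "(f has_derivative frechet_derivative F (at p)) (at p within M)"
    by (rule has_derivative_transform_within[OF
          has_derivative_at_withinI[OF smooth_on_open_has_derivative[OF F(2,1)]] d(1) assms(2)])
       (use d F(3) in \<open>auto simp: dist_commute subset_eq\<close>)
  then show ?thesis
    unfolding deriv_along_def by (subst frechet_derivative_works[symmetric]) (rule differentiableI)
qed

text \<open>On tangent vectors the choice is harmless by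
  \<open>derivative_within_tangent_unique\<close>. The calculus rules below follow from the usual
  ones in this way, which is why they assume tangency.\<close>

lemma deriv_along_eq:
  assumes "(f has_derivative f') (at p within M)" "v \<in> tangent_space M p"
  shows "deriv_along M f p v = f' v"
proof -
  have "(f has_derivative deriv_along M f p) (at p within M)"
    unfolding deriv_along_def
    by (subst frechet_derivative_works[symmetric]) (rule differentiableI[OF assms(1)])
  then show ?thesis by (rule derivative_within_tangent_unique[OF assms(2) _ assms(1)])
qed

text \<open>The equality covers all ambient vectors, tangent or not, because both derivatives are
  chosen by the same predicate.\<close>

lemma deriv_along_cong:
  assumes "\<And>q. q \<in> M \<Longrightarrow> f q = g q" "p \<in> M"
  shows "deriv_along M f p = deriv_along M g p"
proof -
  have "(f has_derivative D) (at p within M) \<longleftrightarrow> (g has_derivative D) (at p within M)" for D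
    using has_derivative_transform[of p M f g D] has_derivative_transform[of p M g f D] assms by auto
  then show ?thesis by (simp add: deriv_along_def frechet_derivative_def fun_eq_iff)
qed

lemma linear_deriv_along: "smooth_on M f \<Longrightarrow> p \<in> M \<Longrightarrow> linear (deriv_along M f p)"
  using has_derivative_deriv_along has_derivative_linear by blast

lemma deriv_along_const: "v \<in> tangent_space M p \<Longrightarrow> deriv_along M (\<lambda>q. c) p v = 0"
  by (rule deriv_along_eq) auto

lemma deriv_along_linear:
  assumes "bounded_linear L" "smooth_on M f" "p \<in> M" "v \<in> tangent_space M p"
  shows "deriv_along M (\<lambda>q. L (f q)) p v = L (deriv_along M f p v)"
  by (rule deriv_along_eq[OF bounded_linear.has_derivative[OF assms(1)
          has_derivative_deriv_along[OF assms(2,3)]] assms(4)])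

lemma deriv_along_bounded_linear:
  "bounded_linear L \<Longrightarrow> v \<in> tangent_space M p \<Longrightarrow> deriv_along M L p v = L v"
  by (rule deriv_along_eq) (rule bounded_linear_imp_has_derivative)

lemma deriv_along_add:
  assumes "smooth_on M f" "smooth_on M g" "p \<in> M" "v \<in> tangent_space M p"
  shows "deriv_along M (\<lambda>q. f q + g q) p v = deriv_along M f p v + deriv_along M g p v"
  by (rule deriv_along_eq[OF has_derivative_add[OF has_derivative_deriv_along[OF assms(1,3)]
          has_derivative_deriv_along[OF assms(2,3)]] assms(4)])

lemma deriv_along_diff:
  assumes "smooth_on M f" "smooth_on M g" "p \<in> M" "v \<in> tangent_space M p"
  shows "deriv_along M (\<lambda>q. f q - g q) p v = deriv_along M f p v - deriv_along M g p v"
  by (rule deriv_along_eq[OF has_derivative_diff[OF has_derivative_deriv_along[OF assms(1,3)]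
          has_derivative_deriv_along[OF assms(2,3)]] assms(4)])

lemma deriv_along_bilinear:
  assumes "bounded_bilinear h" "smooth_on M f" "smooth_on M g" "p \<in> M" "v \<in> tangent_space M p"
  shows "deriv_along M (\<lambda>q. h (f q) (g q)) p v =
    h (f p) (deriv_along M g p v) + h (deriv_along M f p v) (g p)"
  by (rule deriv_along_eq[OF bounded_bilinear.FDERIV[OF assms(1)
          has_derivative_deriv_along[OF assms(2,4)] has_derivative_deriv_along[OF assms(3,4)]] assms(5)])

lemma vector_field_smooth: "vector_field M X \<Longrightarrow> smooth_on M X"
  and vector_field_tangent: "vector_field M X \<Longrightarrow> p \<in> M \<Longrightarrow> X p \<in> tangent_space M p"
  by (auto simp: vector_field_def)

lemma deriv_along_smooth_extension:
  assumes "smooth_on_open U F" "\<And>q. q \<in> M \<inter> U \<Longrightarrow> F q = f q" "q \<in> M \<inter> U" "v \<in> tangent_space M q"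
  shows "deriv_along M f q v = frechet_derivative F (at q) v"
  using assms smooth_on_open_open[OF assms(1)]
  by (intro deriv_along_extension[of v M q U F]) (auto intro: smooth_on_open_has_derivative)

lemma smooth_on_deriv_along:
  assumes f: "smooth_on M f" and X: "vector_field M X"
  shows "smooth_on M (\<lambda>q. deriv_along M f q (X q))"
  unfolding smooth_on_def
proof
  fix p assume "p \<in> M"
  from smooth_onE2[OF f vector_field_smooth[OF X] this] obtain U F G
    where U: "p \<in> U" "smooth_on_open U F" "smooth_on_open U G"
      "\<And>q. q \<in> M \<inter> U \<Longrightarrow> F q = f q" "\<And>q. q \<in> M \<inter> U \<Longrightarrow> G q = X q"
    by metis
  have "frechet_derivative F (at q) (G q) = deriv_along M f q (X q)" if "q \<in> M \<inter> U" for q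
    using deriv_along_smooth_extension[OF U(2,4) that] vector_field_tangent[OF X] that U(5)[OF that]
    by simp
  then show "\<exists>U F. p \<in> U \<and> smooth_on_open U F \<and> (\<forall>q\<in>M \<inter> U. F q = deriv_along M f q (X q))"
    using smooth_on_open_frechet_derivative_field[OF U(2,3)] U(1) by blast
qed

text \<open>Expanding \<open>G q\<close> in the standard basis leaves only second derivatives in
  constant directions, to which Clairaut's theorem applies; the last summand comes from
  differentiating the direction.\<close>

lemma frechet_derivative_directional_derivative:
  fixes G :: "'a::euclidean_space \<Rightarrow> 'a"
  assumes F: "smooth_on_open U F" and G: "smooth_on_open U G" and p: "p \<in> U"
  shows "frechet_derivative (\<lambda>q. frechet_derivative F (at q) (G q)) (at p) v =
    (\<Sum>b\<in>Basis. (G p \<bullet> b) *\<^sub>R frechet_derivative (\<lambda>q. frechet_derivative F (at q) b) (at p) v) +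
    frechet_derivative F (at p) (frechet_derivative G (at p) v)"
proof -
  have lin: "frechet_derivative F (at q) u = (\<Sum>b\<in>Basis. (u \<bullet> b) *\<^sub>R frechet_derivative F (at q) b)"
    if "q \<in> U" for q u
  proof -
    have "linear (frechet_derivative F (at q))"
      using smooth_on_open_has_derivative[OF F that] has_derivative_linear by blast
    then have "frechet_derivative F (at q) (\<Sum>b\<in>Basis. (u \<bullet> b) *\<^sub>R b) =
        (\<Sum>b\<in>Basis. (u \<bullet> b) *\<^sub>R frechet_derivative F (at q) b)"
      by (simp add: linear_sum linear_cmul)
    then show ?thesis by (simp add: euclidean_representation)
  qed
  have "((\<lambda>q. \<Sum>b\<in>Basis. (G q \<bullet> b) *\<^sub>R frechet_derivative F (at q) b) has_derivative
      (\<lambda>v. \<Sum>b\<in>Basis. (G p \<bullet> b) *\<^sub>R frechet_derivative (\<lambda>q. frechet_derivative F (at q) b) (at p) v +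
        (frechet_derivative G (at p) v \<bullet> b) *\<^sub>R frechet_derivative F (at p) b)) (at p)"
    by (intro has_derivative_sum has_derivative_scaleR has_derivative_inner_left
        smooth_on_open_has_derivative[OF G p]
        smooth_on_open_has_derivative[OF smooth_on_open_frechet_derivative[OF F] p])
  then have "((\<lambda>q. frechet_derivative F (at q) (G q)) has_derivative
      (\<lambda>v. \<Sum>b\<in>Basis. (G p \<bullet> b) *\<^sub>R frechet_derivative (\<lambda>q. frechet_derivative F (at q) b) (at p) v +
        (frechet_derivative G (at p) v \<bullet> b) *\<^sub>R frechet_derivative F (at p) b)) (at p)"
    by (rule has_derivative_transform_within_open[OF _ smooth_on_open_open[OF F] p])
      (simp flip: lin)
  from fun_cong[OF frechet_derivative_at[OF this], of v]
  have "frechet_derivative (\<lambda>q. frechet_derivative F (at q) (G q)) (at p) v =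
      (\<Sum>b\<in>Basis. (G p \<bullet> b) *\<^sub>R frechet_derivative (\<lambda>q. frechet_derivative F (at q) b) (at p) v +
        (frechet_derivative G (at p) v \<bullet> b) *\<^sub>R frechet_derivative F (at p) b)"
    by simp
  also have "\<dots> = (\<Sum>b\<in>Basis. (G p \<bullet> b) *\<^sub>R frechet_derivative (\<lambda>q. frechet_derivative F (at q) b) (at p) v) +
    frechet_derivative F (at p) (frechet_derivative G (at p) v)"
    by (simp add: sum.distrib flip: lin[OF p])
  finally show ?thesis .
qed

text \<open>By Clairaut's theorem the second-order parts of the two iterated derivatives agree,
  which leaves the derivative of \<open>f\<close> along \<open>dY(X) - dX(Y)\<close>. Tangency of
  the bracket is assumed because \<open>deriv_along\<close> is determined by \<open>f\<close> on
  tangent vectors only; for \<open>SL\<close> it comes from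
  \<open>lie_bracket_SL_vector_field\<close>.\<close>

lemma deriv_along_commutator:
  fixes f :: "'a::euclidean_space \<Rightarrow> 'b::euclidean_space"
  assumes f: "smooth_on M f" and X: "vector_field M X" and Y: "vector_field M Y" and p: "p \<in> M"
    and br: "lie_bracket M X Y p \<in> tangent_space M p"
  shows "deriv_along M (\<lambda>q. deriv_along M f q (Y q)) p (X p) -
      deriv_along M (\<lambda>q. deriv_along M f q (X q)) p (Y p) = deriv_along M f p (lie_bracket M X Y p)"
proof -
  obtain U1 F where F: "p \<in> U1" "smooth_on_open U1 F" "\<And>q. q \<in> M \<inter> U1 \<Longrightarrow> F q = f q"
    using smooth_onE[OF f p] by metis
  from smooth_onE2[OF vector_field_smooth[OF X] vector_field_smooth[OF Y] p] obtain U2 A B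
    where U2: "p \<in> U2" "smooth_on_open U2 A" "smooth_on_open U2 B"
      "\<And>q. q \<in> M \<inter> U2 \<Longrightarrow> A q = X q" "\<And>q. q \<in> M \<inter> U2 \<Longrightarrow> B q = Y q"
    by metis
  define U where "U = U1 \<inter> U2"
  have pU: "p \<in> U" and pMU: "p \<in> M \<inter> U" using F U2 p by (auto simp: U_def)
  have o: "open U" using F(2) U2(2) by (auto simp: U_def intro: smooth_on_open_open)
  have sF: "smooth_on_open U F" and sA: "smooth_on_open U A" and sB: "smooth_on_open U B"
    using F(2) U2(2,3) o by (auto simp: U_def intro: smooth_on_open_subset)
  have eF: "F q = f q" and eA: "A q = X q" and eB: "B q = Y q" if "q \<in> M \<inter> U" for q
    using that F(3) U2(4,5) by (auto simp: U_def)
  note DF = deriv_along_smooth_extension[OF sF eF]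
  note dF = deriv_along_smooth_extension[OF sF eF pMU] deriv_along_smooth_extension[OF sA eA pMU]
    deriv_along_smooth_extension[OF sB eB pMU]
  have T: "X p \<in> tangent_space M p" "Y p \<in> tangent_space M p"
    using X Y p by (auto simp: vector_field_def)
  define H where "H b c = frechet_derivative (\<lambda>q. frechet_derivative F (at q) b) (at p) c" for b c
  have second: "deriv_along M (\<lambda>q. deriv_along M f q (Y q)) p v =
      (\<Sum>b\<in>Basis. (Y p \<bullet> b) *\<^sub>R H b v) + frechet_derivative F (at p) (deriv_along M Y p v)"
    if Y: "vector_field M Y" and sB: "smooth_on_open U B" and eB: "\<And>q. q \<in> M \<inter> U \<Longrightarrow> B q = Y q"
      and v: "v \<in> tangent_space M p" for Y B v
  proof -
    have "deriv_along M (\<lambda>q. deriv_along M f q (Y q)) p v =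
        frechet_derivative (\<lambda>q. frechet_derivative F (at q) (B q)) (at p) v"
    proof (rule deriv_along_smooth_extension[OF _ _ pMU v])
      show "smooth_on_open U (\<lambda>q. frechet_derivative F (at q) (B q))"
        by (rule smooth_on_open_frechet_derivative_field[OF sF sB])
      show "frechet_derivative F (at q) (B q) = deriv_along M f q (Y q)" if "q \<in> M \<inter> U" for q
        using DF[OF _ that] vector_field_tangent[OF Y] that eB[OF that] by simp
    qed
    then show ?thesis
      using frechet_derivative_directional_derivative[OF sF sB pU, of v]
        deriv_along_smooth_extension[OF sB eB pMU v] eB[OF pMU]
      by (simp add: H_def)
  qed
  have lin: "H b v = (\<Sum>c\<in>Basis. (v \<bullet> c) *\<^sub>R H b c)" for b v
  proof -
    have "linear (H b)"
      unfolding H_def using has_derivative_linear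
        smooth_on_open_has_derivative[OF smooth_on_open_frechet_derivative[OF sF] pU] by blast
    then have "H b (\<Sum>c\<in>Basis. (v \<bullet> c) *\<^sub>R c) = (\<Sum>c\<in>Basis. (v \<bullet> c) *\<^sub>R H b c)"
      by (simp add: linear_sum linear_cmul)
    then show ?thesis by (simp add: euclidean_representation)
  qed
  have sym: "H b c = H c b" for b c
    unfolding H_def by (rule second_derivative_symmetric[OF sF pU])
  have "(\<Sum>b\<in>Basis. (Y p \<bullet> b) *\<^sub>R H b (X p)) = (\<Sum>b\<in>Basis. (X p \<bullet> b) *\<^sub>R H b (Y p))"
  proof -
    have "(\<Sum>b\<in>Basis. (Y p \<bullet> b) *\<^sub>R H b (X p)) =
        (\<Sum>b\<in>Basis. \<Sum>c\<in>Basis. (Y p \<bullet> b) *\<^sub>R (X p \<bullet> c) *\<^sub>R H b c)"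
      by (subst lin) (simp add: scaleR_right.sum)
    also have "\<dots> = (\<Sum>c\<in>Basis. \<Sum>b\<in>Basis. (X p \<bullet> c) *\<^sub>R (Y p \<bullet> b) *\<^sub>R H c b)"
      by (subst sum.swap) (simp add: mult.commute sym)
    also have "\<dots> = (\<Sum>b\<in>Basis. (X p \<bullet> b) *\<^sub>R H b (Y p))"
      by (subst (2) lin) (simp add: scaleR_right.sum)
    finally show ?thesis .
  qed
  moreover have "linear (frechet_derivative F (at p))"
    using smooth_on_open_has_derivative[OF sF pU] has_derivative_linear by blast
  moreover have "deriv_along M f p (lie_bracket M X Y p) = frechet_derivative F (at p) (lie_bracket M X Y p)"
    using DF[OF _ pMU br] by simp
  ultimately show ?thesis
    using second[OF Y sB eB T(1)] second[OF X sA eA T(2)]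
    by (simp add: lie_bracket_def linear_diff)
qed

section \<open>Uniqueness of the Levi-Civita connection\<close>

lemma levi_civita_vector_field:
  "is_levi_civita M g nab \<Longrightarrow> vector_field M X \<Longrightarrow> vector_field M Y \<Longrightarrow> vector_field M (nab X Y)"
  by (simp add: is_levi_civita_def affine_connection_def)

lemma levi_civita_torsion_free:
  assumes "is_levi_civita M g nab" "vector_field M X" "vector_field M Y" "p \<in> M"
  shows "nab X Y p - nab Y X p = lie_bracket M X Y p"
  using assms(1)[unfolded is_levi_civita_def, THEN conjunct2, THEN conjunct1] assms(2-) by simp

lemma levi_civita_metric:
  assumes "is_levi_civita M g nab" "vector_field M X" "vector_field M Y" "vector_field M Z" "p \<in> M"
  shows "deriv_along M (\<lambda>q. g q (Y q) (Z q)) p (X p) = g p (nab X Y p) (Z p) + g p (Y p) (nab X Z p)"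
  using assms(1)[unfolded is_levi_civita_def, THEN conjunct2, THEN conjunct2] assms(2-) by simp

text \<open>The difference tensor \<open>g(S(X,Y),Z)\<close> of two Levi-Civita connections is symmetric in \<open>X, Y\<close>
  and skew in \<open>Y, Z\<close>, hence zero.\<close>

lemma levi_civita_unique:
  assumes lc: "is_levi_civita M g nab" "is_levi_civita M g nab'"
    and X: "vector_field M X" and Y: "vector_field M Y" and p: "p \<in> M"
    and form: "nondegenerate_symmetric_form (tangent_space M p) (g p)"
    and sub: "subspace (tangent_space M p)"
    and ext: "\<And>z. z \<in> tangent_space M p \<Longrightarrow> \<exists>Z. vector_field M Z \<and> Z p = z"
  shows "nab X Y p = nab' X Y p"
proof -
  let ?T = "tangent_space M p"
  define S where "S X Y = nab X Y p - nab' X Y p" for X Y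
  have T: "nab X Y p \<in> ?T" "nab' X Y p \<in> ?T" if "vector_field M X" "vector_field M Y" for X Y
    using levi_civita_vector_field[OF lc(1) that] levi_civita_vector_field[OF lc(2) that] p
    by (simp_all add: vector_field_tangent)
  have ST: "S X Y \<in> ?T" if "vector_field M X" "vector_field M Y" for X Y
    unfolding S_def using T[OF that] sub subspace_diff by blast
  have g_sym: "g p x y = g p y x" if "x \<in> ?T" "y \<in> ?T" for x y
    using form that unfolding nondegenerate_symmetric_form_def by blast
  have g_diff: "g p (x - y) z = g p x z - g p y z" if "x \<in> ?T" "y \<in> ?T" "z \<in> ?T" for x y z
  proof -
    have "g p (1 *\<^sub>R x + (- 1) *\<^sub>R y) z = 1 * g p x z + (- 1) * g p y z"
      using form that unfolding nondegenerate_symmetric_form_def by blast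
    then show ?thesis by simp
  qed
  have S_sym: "S X Y = S Y X" if "vector_field M X" "vector_field M Y" for X Y
  proof -
    have "nab X Y p - nab Y X p = nab' X Y p - nab' Y X p"
      using levi_civita_torsion_free[OF lc(1) that p] levi_civita_torsion_free[OF lc(2) that p] by simp
    then show ?thesis unfolding S_def by (simp add: algebra_simps)
  qed
  have skew: "g p (S X Y) (Z p) = - g p (S X Z) (Y p)"
    if v: "vector_field M X" "vector_field M Y" "vector_field M Z" for X Y Z
  proof -
    have "g p (nab X Y p) (Z p) + g p (Y p) (nab X Z p) = g p (nab' X Y p) (Z p) + g p (Y p) (nab' X Z p)"
      using levi_civita_metric[OF lc(1) v p] levi_civita_metric[OF lc(2) v p] by simp
    moreover have "g p (Y p) (nab X Z p) = g p (nab X Z p) (Y p)"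
      "g p (Y p) (nab' X Z p) = g p (nab' X Z p) (Y p)"
      by (intro g_sym T v vector_field_tangent[OF _ p])+
    moreover have "g p (S X Y) (Z p) = g p (nab X Y p) (Z p) - g p (nab' X Y p) (Z p)"
      "g p (S X Z) (Y p) = g p (nab X Z p) (Y p) - g p (nab' X Z p) (Y p)"
      unfolding S_def by (intro g_diff T v vector_field_tangent[OF _ p])+
    ultimately show ?thesis by simp
  qed
  have "g p (S X Y) z = 0" if z: "z \<in> ?T" for z
  proof -
    obtain Z where Z: "vector_field M Z" "Z p = z" using ext[OF z] by blast
    \<comment> \<open>Writing \<open>(X,Y,Z)\<close> for \<open>g p (S X Y) (Z p)\<close>, skewness
      followed by symmetry sends \<open>(X,Y,Z)\<close> to minus \<open>(Z,X,Y)\<close>; three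
      rounds return to the start with the sign reversed.\<close>
    have "g p (S X Y) (Z p) = - g p (S X Y) (Z p)"
      using skew[OF X Y Z(1)] skew[OF Z(1) X Y] skew[OF Y Z(1) X]
        S_sym[OF X Y] S_sym[OF X Z(1)] S_sym[OF Y Z(1)] by simp
    then show ?thesis using Z(2) by simp
  qed
  then have "S X Y = 0"
    using form ST[OF X Y] unfolding nondegenerate_symmetric_form_def by blast
  then show ?thesis by (simp add: S_def)
qed

section \<open>Matrices\<close>

lemma bounded_bilinear_matrix_mult:
  "bounded_bilinear ((**) :: real^'n^'m \<Rightarrow> real^'p^'n \<Rightarrow> real^'p^'m)"
  unfolding bilinear_conv_bounded_bilinear[symmetric] bilinear_def
  by (auto intro!: linearI simp: matrix_add_ldistrib matrix_scalar_ac scalar_matrix_assoc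
      matrix_matrix_mult_def vec_eq_iff sum.distrib distrib_right distrib_left sum_distrib_left mult_ac)

interpretation matrix_mult: bounded_bilinear "(**) :: real^'n^'m \<Rightarrow> real^'p^'n \<Rightarrow> real^'p^'m"
  by (rule bounded_bilinear_matrix_mult)

lemma bounded_linear_trace: "bounded_linear (trace :: real^'n^'n \<Rightarrow> real)"
  unfolding linear_conv_bounded_linear[symmetric]
  by (auto intro!: linearI simp: trace_def sum.distrib sum_distrib_left)

lemma trace_scaleR: "trace (c *\<^sub>R A) = c * trace (A :: real^'n^'n)"
  by (simp add: trace_def sum_distrib_left)

lemma trace_mult_transpose: "trace (A ** B) = transpose A \<bullet> (B :: real^'n^'n)"
  by (simp add: trace_def matrix_matrix_mult_def inner_vec_def transpose_def)
     (rule sum.swap)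

lemma euclidean_matrix_expansion:
  "(\<Sum>i\<in>UNIV. \<Sum>j\<in>UNIV. A$i$j *\<^sub>R axis i (axis j 1)) = (A :: real^'n^'m)"
proof -
  have "(\<Sum>i\<in>UNIV. \<Sum>j\<in>UNIV. A$i$j *\<^sub>R (axis i (axis j 1) :: real^'n^'m)) $ k $ l =
      (\<Sum>i\<in>UNIV. \<Sum>j\<in>UNIV. if i = k \<and> j = l then A$k$l else 0)" for k l
    by (auto simp: axis_def intro!: sum.cong)
  also have "\<dots> k l = (\<Sum>i\<in>UNIV. if i = k then A$k$l else 0)" for k l
    by (intro sum.cong refl) auto
  finally show ?thesis by (simp add: vec_eq_iff)
qed

lemma smooth_on_open_matrix:
  assumes "open U" "\<And>i j. smooth_on_open U (\<lambda>x. A x $ i $ j)"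
  shows "smooth_on_open U (A :: _ \<Rightarrow> real^'n^'m)"
proof -
  have "smooth_on_open U (\<lambda>x. \<Sum>i\<in>UNIV. \<Sum>j\<in>UNIV. A x$i$j *\<^sub>R (axis i (axis j 1) :: real^'n^'m))"
    by (intro smooth_on_open_sum smooth_on_open_scaleR smooth_on_open_const assms)
  then show ?thesis by (simp add: euclidean_matrix_expansion)
qed

lemma bounded_linear_entry: "bounded_linear (\<lambda>A. A $ i $ j :: real)"
  using bounded_linear_compose[OF bounded_linear_vec_nth[of j] bounded_linear_vec_nth[of i]] .

lemma smooth_on_open_entry:
  "smooth_on_open U A \<Longrightarrow> smooth_on_open U (\<lambda>x. A x $ i $ j :: real)"
  by (rule smooth_on_open_linear_compose[OF bounded_linear_entry])

lemma smooth_on_open_det: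
  fixes A :: "_ \<Rightarrow> real^'n^'n"
  assumes "open U" "\<And>i j. smooth_on_open U (\<lambda>x. A x $ i $ j)"
  shows "smooth_on_open U (\<lambda>x. det (A x))"
  unfolding det_def
  by (intro smooth_on_open_sum smooth_on_open_mult smooth_on_open_prod smooth_on_open_const assms)

lemma matrix_inv_det_nonzero:
  fixes A :: "real^'n^'n"
  assumes "det A \<noteq> 0"
  shows "A ** matrix_inv A = mat 1" "matrix_inv A ** A = mat 1"
proof -
  have "\<exists>B. A ** B = mat 1 \<and> B ** A = mat 1"
    using assms invertible_det_nz[of A] by (simp add: invertible_def)
  from someI_ex[OF this]
  show "A ** matrix_inv A = mat 1" "matrix_inv A ** A = mat 1"
    by (simp_all add: matrix_inv_def)
qed

lemma matrix_inv_unique: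
  fixes A B :: "real^'n^'n"
  assumes "B ** A = mat 1"
  shows "matrix_inv A = B"
proof -
  have "det B * det A = 1" using assms by (metis det_I det_mul)
  then have "A ** matrix_inv A = mat 1" by (intro matrix_inv_det_nonzero) auto
  then show ?thesis using assms by (metis matrix_mul_assoc matrix_mul_lid matrix_mul_rid)
qed

lemma SL_det: "A \<in> SL \<Longrightarrow> det A = 1"
  by (simp add: SL_def)

lemma SL_inv [simp]:
  assumes "A \<in> SL"
  shows "A ** matrix_inv A = mat 1" "matrix_inv A ** A = mat 1"
    "B ** A ** matrix_inv A = B" "B ** matrix_inv A ** A = B"
  using matrix_inv_det_nonzero[of A] assms by (simp_all add: SL_det flip: matrix_mul_assoc)

lemma SL_mult: "A \<in> SL \<Longrightarrow> B \<in> SL \<Longrightarrow> A ** B \<in> SL"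
  by (simp add: SL_def det_mul)

lemma mat_1_SL: "mat 1 \<in> SL"
  by (simp add: SL_def)

lemma matrix_inv_SL:
  assumes "A \<in> SL"
  shows "matrix_inv A \<in> SL"
proof -
  have "det (A ** matrix_inv A) = 1" by (simp add: assms)
  then show ?thesis using assms by (simp add: SL_def det_mul)
qed

text \<open>For determinant one, Cramer's rule gives the inverse as the adjugate, which is
  polynomial in the entries. The adjugate thus serves as a smooth extension of
  \<open>matrix_inv\<close> from \<open>SL\<close> to all matrices.\<close>

lemma matrix_inv_cramer:
  fixes A :: "real^'n^'n"
  assumes "det A = 1"
  shows "matrix_inv A = (\<chi> k j. det (\<chi> i l. if l = k then (if i = j then 1 else 0) else A $ i $ l))"
proof -
  have "matrix_inv A $ k $ j = det (\<chi> i l. if l = k then (if i = j then 1 else 0) else A $ i $ l)" for k j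
  proof -
    have "A *v (matrix_inv A *v axis j 1) = axis j 1"
      using assms by (simp add: matrix_vector_mul_assoc matrix_inv_det_nonzero)
    then have "matrix_inv A *v axis j 1 = (\<chi> k. det (\<chi> i l. if l = k then axis j 1 $ i else A $ i $ l) / det A)"
      using cramer[of A] assms by simp
    then have "(matrix_inv A *v axis j 1) $ k = det (\<chi> i l. if l = k then axis j 1 $ i else A $ i $ l)"
      using assms by simp
    moreover have "(matrix_inv A *v axis j 1) $ k = matrix_inv A $ k $ j"
      by (simp add: matrix_vector_mul_component inner_axis)
    ultimately show ?thesis by (simp add: axis_def eq_commute cong: if_cong)
  qed
  then show ?thesis by (simp add: vec_eq_iff)
qed

lemma smooth_on_matrix_inv: "smooth_on SL (matrix_inv :: real^'n^'n \<Rightarrow> real^'n^'n)"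
proof -
  have "smooth_on_open UNIV (\<lambda>A::real^'n^'n. (\<chi> k j. det (\<chi> i l. if l = k then (if i = j then 1 else 0)
      else A $ i $ l)) :: real^'n^'n)" (is "smooth_on_open _ ?adj")
  proof (intro smooth_on_open_matrix open_UNIV, simp, intro smooth_on_open_det open_UNIV)
    fix k j i l
    show "smooth_on_open UNIV (\<lambda>A::real^'n^'n. (\<chi> i l. if l = k then (if i = j then 1 else 0) else A $ i $ l) $ i $ l)"
      by (cases "l = k"; cases "i = j")
        (simp_all add: smooth_on_open_const smooth_on_open_bounded_linear bounded_linear_entry)
  qed
  then have "smooth_on SL ?adj" by (rule smooth_on_open_imp_smooth_on) simp
  then show ?thesis
    by (subst smooth_on_cong[of SL matrix_inv ?adj]) (simp_all only: matrix_inv_cramer SL_det)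
qed

section \<open>Derivative of the determinant at the identity, and its dependence on one diagonal
  entry\<close>

lemma has_derivative_det_mat_1:
  fixes B :: "real \<Rightarrow> real^'n^'n"
  assumes "(B has_vector_derivative v) (at 0)" "B 0 = mat 1"
  shows "((\<lambda>t. det (B t)) has_real_derivative trace v) (at 0)"
proof -
  let ?P = "{p. p permutes (UNIV :: 'n set)}"
  have B: "((\<lambda>t. B t $ i $ j) has_derivative (\<lambda>t. t * v $ i $ j)) (at 0)" for i j
    using bounded_linear.has_derivative[OF bounded_linear_entry assms(1)[unfolded has_vector_derivative_def], of i j]
    by simp
  \<comment> \<open>A permutation other than the identity moves at least two points, so its product
    in the Leibniz formula still contains a zero after one factor is removed. Only the product of
    the diagonal entries contributes, and it gives the trace.\<close>
  have prod0: "(\<Prod>j\<in>UNIV - {i}. B 0 $ j $ p j) = (if p = id then 1 else 0)" if p: "p \<in> ?P" for p i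
  proof (cases "p = id")
    case False
    obtain j where j: "p j \<noteq> j" "j \<noteq> i"
    proof (cases "\<exists>j. p j \<noteq> j \<and> j \<noteq> i")
      case False
      then have fixed: "p j = j" if "j \<noteq> i" for j using that by blast
      with \<open>p \<noteq> id\<close> have "p i \<noteq> i" by (metis eq_id_iff)
      moreover have "p (p i) = p i" using fixed calculation by blast
      ultimately show thesis using p by (metis mem_Collect_eq permutes_def)
    qed (use that in blast)
    then have "(\<Prod>j\<in>UNIV - {i}. B 0 $ j $ p j) = 0"
      by (intro prod_zero) (auto simp: assms(2) mat_def intro!: bexI[of _ j])
    with False show ?thesis by simp
  qed (simp add: assms(2) mat_def)
  have "((\<lambda>t. det (B t)) has_derivative
      (\<lambda>t. \<Sum>p\<in>?P. of_int (sign p) * (\<Sum>i\<in>UNIV. t * v $ i $ p i * (\<Prod>j\<in>UNIV - {i}. B 0 $ j $ p j)))) (at 0)"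
    unfolding det_def by (intro has_derivative_sum has_derivative_mult_right has_derivative_prod B)
  moreover have "(\<Sum>p\<in>?P. of_int (sign p) * (\<Sum>i\<in>UNIV. t * v $ i $ p i * (\<Prod>j\<in>UNIV - {i}. B 0 $ j $ p j))) =
      trace v * t" for t
  proof -
    have "(\<Sum>p\<in>?P. of_int (sign p) * (\<Sum>i\<in>UNIV. t * v $ i $ p i * (\<Prod>j\<in>UNIV - {i}. B 0 $ j $ p j))) =
        (\<Sum>p\<in>?P. if p = id then \<Sum>i\<in>UNIV. t * v $ i $ i else 0)"
      by (intro sum.cong refl) (simp add: prod0 sign_id)
    also have "\<dots> = (\<Sum>i\<in>UNIV. t * v $ i $ i)"
      by (simp add: finite_permutations permutes_id)
    finally show ?thesis by (simp add: trace_def sum_distrib_left mult.commute)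
  qed
  ultimately show ?thesis by (simp add: has_field_derivative_def)
qed

definition set_diag :: "'n \<Rightarrow> real^'n^'n \<Rightarrow> real \<Rightarrow> real^'n^'n" where
  "set_diag k B s = B + (s - B$k$k) *\<^sub>R axis k (axis k 1)"

lemma set_diag_nth [simp]: "set_diag k B s $ k $ k = s"
  by (simp add: set_diag_def)

lemma set_diag_set_diag [simp]: "set_diag k (set_diag k B s) t = set_diag k B t"
  by (simp add: set_diag_def algebra_simps flip: scaleR_add_left)

lemma set_diag_same: "s = B $ k $ k \<Longrightarrow> set_diag k B s = B"
  by (simp add: set_diag_def)

text \<open>The cofactor of the entry \<open>(k,k)\<close>, taken as the slope of the determinant in
  that entry. In this form it is smooth because \<open>det\<close> is, and it visibly does not
  depend on the entry itself.\<close>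

definition diag_cofactor :: "'n \<Rightarrow> real^'n^'n \<Rightarrow> real" where
  "diag_cofactor k B = det (set_diag k B 1) - det (set_diag k B 0)"

text \<open>Linearity in row \<open>k\<close>, split into the row with its diagonal entry set to
  zero and \<open>s\<close> times a unit vector. The auxiliary \<open>c\<close> is independent of
  \<open>s\<close>; the case \<open>s = 1\<close> identifies it with the cofactor.\<close>

lemma det_set_diag: "det (set_diag k B s) = det (set_diag k B 0) + s * diag_cofactor k B"
proof -
  define c where "c = det (\<chi> i. if i = k then axis k 1 else B $ i)"
  have "det (set_diag k B s) = det (set_diag k B 0) + s * c" for s
  proof -
    let ?a = "\<lambda>i. set_diag k B 0 $ i"
    have "set_diag k B s = (\<chi> i. if i = k then ?a i + s *s axis k 1 else ?a i)"
      by (simp add: set_diag_def vec_eq_iff axis_def)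
    moreover have "(\<chi> i. if i = k then ?a i else ?a i) = set_diag k B 0"
      by (simp add: vec_eq_iff)
    moreover have "(\<chi> i. if i = k then axis k 1 else ?a i) = (\<chi> i. if i = k then axis k 1 else B $ i)"
      by (simp add: set_diag_def vec_eq_iff axis_def)
    ultimately show ?thesis
      using det_row_add[of k ?a "\<lambda>_. s *s axis k 1" ?a] det_row_mul[of k s "\<lambda>_. axis k 1" ?a]
      by (simp add: c_def)
  qed
  from this[of s] this[of 1] show ?thesis by (simp add: diag_cofactor_def)
qed

lemma det_diag_cofactor: "det B = det (set_diag k B 0) + B$k$k * diag_cofactor k B"
  using det_set_diag[of k B "B$k$k"] by (simp add: set_diag_same)

lemma diag_cofactor_set_diag [simp]: "diag_cofactor k (set_diag k B s) = diag_cofactor k B"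
  by (simp add: diag_cofactor_def)

lemma diag_cofactor_mat_1: "diag_cofactor k (mat 1) = 1"
proof -
  have "det (set_diag k (mat 1) 0) = (\<Prod>i\<in>UNIV. set_diag k (mat 1) 0 $ i $ i)"
    by (rule det_diagonal) (auto simp: set_diag_def mat_def axis_def)
  also have "\<dots> = 0" by (rule prod_zero) (auto intro: exI[of _ k])
  finally have "det (set_diag k (mat 1) 0) = 0" .
  moreover have "set_diag k (mat 1) 1 = mat 1" by (rule set_diag_same) (simp add: mat_def)
  ultimately show ?thesis by (simp add: diag_cofactor_def)
qed

lemma smooth_on_open_set_diag:
  assumes "smooth_on_open U A" "smooth_on_open U s"
  shows "smooth_on_open U (\<lambda>x. set_diag k (A x) (s x))"
  unfolding set_diag_def
  by (intro smooth_on_open_add smooth_on_open_scaleR smooth_on_open_diff smooth_on_open_entry assms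
      smooth_on_open_const smooth_on_open_open[OF assms(1)])

lemma smooth_on_open_diag_cofactor:
  assumes "smooth_on_open U A"
  shows "smooth_on_open U (\<lambda>x. diag_cofactor k (A x))"
  unfolding diag_cofactor_def
  by (intro smooth_on_open_diff smooth_on_open_det smooth_on_open_entry smooth_on_open_set_diag assms
      smooth_on_open_const smooth_on_open_open[OF assms(1)])

section \<open>The special linear group as a submanifold\<close>

text \<open>Left translation by \<open>matrix_inv A\<close> moves the curve to the identity, so the
  derivative of \<open>det\<close> is needed only there, where it is the trace; along the curve the
  determinant is constant.\<close>

lemma tangent_space_SL_subset:
  assumes A: "A \<in> (SL :: (real^'n^'n) set)" and v: "v \<in> tangent_space SL A"
  shows "trace (matrix_inv A ** v) = 0"
proof -
  obtain e \<gamma> where e: "e > 0" and \<gamma>: "\<gamma> ` {-e<..<e} \<subseteq> SL" "\<gamma> (0::real) = A"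
    and d\<gamma>: "(\<gamma> has_vector_derivative v) (at 0)"
    using v unfolding tangent_space_def by blast
  have "((\<lambda>t. matrix_inv A ** \<gamma> t) has_vector_derivative matrix_inv A ** v) (at 0)"
    by (rule bounded_linear.has_vector_derivative[OF matrix_mult.bounded_linear_right d\<gamma>])
  then have "((\<lambda>t. det (matrix_inv A ** \<gamma> t)) has_real_derivative trace (matrix_inv A ** v)) (at 0)"
    by (rule has_derivative_det_mat_1) (simp add: \<gamma>(2) A)
  moreover have "((\<lambda>t. det (matrix_inv A ** \<gamma> t)) has_real_derivative 0) (at 0)"
  proof (rule has_field_derivative_transform_within_open[of "\<lambda>t. 1" _ _ "{-e<..<e}"])
    show "1 = det (matrix_inv A ** \<gamma> t)" if "t \<in> {-e<..<e}" for t
    proof -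
      have "\<gamma> t \<in> SL" using \<gamma>(1) that by blast
      then show ?thesis using SL_det[OF SL_mult[OF matrix_inv_SL[OF A]]] by simp
    qed
  qed (use e in auto)
  ultimately show ?thesis by (rule DERIV_unique)
qed

lemma det_set_diag_mat_1: "det (set_diag k (mat 1) s) = s"
  using det_set_diag[of k "mat 1" s] det_diag_cofactor[of "mat 1" k]
  by (simp add: diag_cofactor_mat_1) (simp add: mat_def)

text \<open>The curve \<open>A(I + t A\<^sup>-\<^sup>1W)\<close> is brought back to determinant one by rescaling a single row
  of \<open>I + t A\<^sup>-\<^sup>1W\<close>; to first order this changes nothing.\<close>

lemma tangent_space_SL_superset:
  assumes A: "A \<in> (SL :: (real^'n^'n) set)" and v: "trace (matrix_inv A ** v) = 0"
  shows "v \<in> tangent_space SL A"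
proof -
  define w where "w = matrix_inv A ** v"
  define B where "B = (\<lambda>t::real. mat 1 + t *\<^sub>R w)"
  define k :: 'n where "k = undefined"
  define \<gamma> where "\<gamma> = (\<lambda>t. A ** (set_diag k (mat 1) (inverse (det (B t))) ** B t))"
  have sB: "smooth_on_open U B" if "open U" for U
    unfolding B_def by (intro smooth_on_open_add smooth_on_open_const that
        smooth_on_open_bounded_linear bounded_linear_scaleR_left)
  have B': "(B has_vector_derivative w) (at 0)"
    unfolding B_def by (auto intro!: derivative_eq_intros)
  \<comment> \<open>Tracelessness enters here: the determinant is stationary at 0, hence so is the
    rescaling factor, and the velocity of the curve remains \<open>v\<close>.\<close>
  have det': "((\<lambda>t. det (B t)) has_real_derivative 0) (at 0)"
    using has_derivative_det_mat_1[OF B'] v by (simp add: B_def w_def)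
  have "isCont (\<lambda>t. det (B t)) 0"
    using DERIV_isCont[OF det'] .
  then have "\<forall>\<^sub>F t in at 0. det (B t) \<noteq> 0"
    by (intro tendsto_imp_eventually_ne[of _ 1]) (simp_all add: isCont_def B_def)
  then obtain e where e: "e > 0" "\<And>t. t \<noteq> 0 \<Longrightarrow> dist t 0 < e \<Longrightarrow> det (B t) \<noteq> 0"
    unfolding eventually_at by blast
  have nz: "det (B t) \<noteq> 0" if "t \<in> {-e<..<e}" for t
    using e(2)[of t] that by (cases "t = 0") (simp_all add: B_def dist_real_def abs_less_iff)
  have "smooth_on_open {-e<..<e} \<gamma>"
    unfolding \<gamma>_def
    by (intro smooth_on_open_linear_compose[OF matrix_mult.bounded_linear_right]
        smooth_on_open_bilinear[OF bounded_bilinear_matrix_mult] smooth_on_open_set_diag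
        smooth_on_open_const smooth_on_open_inverse smooth_on_open_det smooth_on_open_entry
        sB nz open_greaterThanLessThan)
  moreover have "\<gamma> ` {-e<..<e} \<subseteq> SL"
    using nz A by (auto simp: \<gamma>_def SL_def det_mul det_set_diag_mat_1)
  moreover have "\<gamma> 0 = A"
  proof -
    have "set_diag k (mat 1) 1 = mat 1" by (rule set_diag_same) (simp add: mat_def)
    then show ?thesis by (simp add: \<gamma>_def B_def)
  qed
  moreover have "(\<gamma> has_vector_derivative v) (at 0)"
  proof -
    have "((\<lambda>t. inverse (det (B t))) has_real_derivative 0) (at 0)"
      using DERIV_inverse_fun[OF det'] by (simp add: B_def)
    then have "((\<lambda>t. inverse (det (B t)) - mat 1 $ k $ k) has_vector_derivative 0) (at 0)"
      by (simp add: has_real_derivative_iff_has_vector_derivative has_vector_derivative_diff_const)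
    from bounded_linear.has_vector_derivative[OF bounded_linear_scaleR_left this, of "axis k (axis k 1) :: real^'n^'n"]
    have "((\<lambda>t. set_diag k (mat 1) (inverse (det (B t)))) has_vector_derivative 0) (at 0)"
      unfolding set_diag_def using has_vector_derivative_add[OF has_vector_derivative_const] by fastforce
    from bounded_bilinear.has_vector_derivative[OF bounded_bilinear_matrix_mult this B']
    have "((\<lambda>t. set_diag k (mat 1) (inverse (det (B t))) ** B t) has_vector_derivative
        set_diag k (mat 1) 1 ** w) (at 0)"
      by (simp add: B_def)
    then have "(\<gamma> has_vector_derivative A ** (set_diag k (mat 1) 1 ** w)) (at 0)"
      unfolding \<gamma>_def by (rule bounded_linear.has_vector_derivative[OF matrix_mult.bounded_linear_right])
    moreover have "set_diag k (mat 1) 1 = mat 1" by (rule set_diag_same) (simp add: mat_def)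
    ultimately show ?thesis using A by (simp add: w_def matrix_mul_assoc)
  qed
  ultimately show ?thesis unfolding tangent_space_def using e(1) by blast
qed

lemma tangent_space_SL: "A \<in> SL \<Longrightarrow> tangent_space SL A = {W. trace (matrix_inv A ** W) = 0}"
  using tangent_space_SL_subset tangent_space_SL_superset by blast

text \<open>In this form the tangent space is the orthogonal complement of one nonzero matrix for
  the Euclidean inner product, from which the subspace property and the dimension are read
  off.\<close>

lemma tangent_space_SL_hyperplane:
  "A \<in> SL \<Longrightarrow> tangent_space SL A = {W. transpose (matrix_inv A) \<bullet> W = 0}"
  by (simp add: tangent_space_SL trace_mult_transpose)

lemma subspace_tangent_space_SL: "A \<in> SL \<Longrightarrow> subspace (tangent_space SL A)"
  by (simp add: tangent_space_SL_hyperplane subspace_hyperplane)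

lemma dim_tangent_space_SL:
  assumes "A \<in> (SL :: (real^'n^'n) set)"
  shows "dim (tangent_space SL A) = CARD('n) * CARD('n) - 1"
proof -
  have "matrix_inv A \<noteq> 0"
  proof
    assume "matrix_inv A = 0"
    then have "(mat 1 :: real^'n^'n) = 0" using SL_inv(2)[OF assms] by simp
    then have "(mat 1 :: real^'n^'n) $ k $ k = 0" for k by simp
    then show False by (simp add: mat_def)
  qed
  then have "transpose (matrix_inv A) \<noteq> 0"
    by (simp add: vec_eq_iff transpose_def) metis
  then show ?thesis
    by (simp add: tangent_space_SL_hyperplane[OF assms] dim_hyperplane)
qed

section \<open>Charts of \<open>SL\<close>\<close>

lemma homeomorphism_smooth:
  assumes "smooth_on_open U f" "smooth_on_open V g"
    and "f ` U \<subseteq> V" "g ` V \<subseteq> U" "\<And>x. x \<in> U \<Longrightarrow> g (f x) = x" "\<And>y. y \<in> V \<Longrightarrow> f (g y) = y"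
  shows "homeomorphism U V f g"
proof (rule homeomorphismI)
  have "C_k_on 0 U f" "C_k_on 0 V g"
    using assms(1,2) unfolding smooth_on_open_def by blast+
  then show "continuous_on U f" "continuous_on V g" by simp_all
qed (use assms in auto)

text \<open>The determinant is affine in each entry. Replacing a diagonal entry of \<open>A\<close> by \<open>det A - 1\<close> is
  therefore a diffeomorphism where the corresponding cofactor does not vanish, and it maps \<open>SL\<close>
  into the hyperplane of matrices in which this entry is zero. Left translation moves this chart
  around the identity to any other point.\<close>

lemma embedded_submanifold_SL: "\<exists>d. embedded_submanifold (SL :: (real^'n^'n) set) d"
proof -
  define k :: 'n where "k = undefined"
  define S where "S = {B :: real^'n^'n. B $ k $ k = 0}"
  have S: "subspace S"
    by (auto simp: S_def subspace_def)
  define f where "f = (\<lambda>A::real^'n^'n. set_diag k A (det A - 1))"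
  \<comment> \<open>The new entry solves \<open>det (set_diag k B s) = B$k$k + 1\<close> for
    \<open>s\<close>, using \<open>det_set_diag\<close>. This inverts \<open>f\<close>, which stores
    \<open>det A - 1\<close> in that entry and changes neither the other entries nor the
    cofactor.\<close>
  define h where "h = (\<lambda>B::real^'n^'n. set_diag k B ((B$k$k + 1 - det (set_diag k B 0)) * inverse (diag_cofactor k B)))"
  have hf: "h (f A) = A" and det_h: "det (h A) = A$k$k + 1" and fh: "f (h A) = A" if "diag_cofactor k A \<noteq> 0" for A
  proof -
    show "h (f A) = A"
      using that det_diag_cofactor[of A k] by (simp add: h_def f_def set_diag_same)
    show "det (h A) = A$k$k + 1"
      unfolding h_def det_set_diag[of k A "_ * _"] using that by (simp add: mult.assoc)
    then show "f (h A) = A"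
      by (simp add: f_def) (simp add: h_def set_diag_same)
  qed
  have cf: "diag_cofactor k (f A) = diag_cofactor k A" and ch: "diag_cofactor k (h A) = diag_cofactor k A" for A
    by (simp_all add: f_def h_def)
  have "embedded_submanifold (SL :: (real^'n^'n) set) (dim S)"
    unfolding embedded_submanifold_def
  proof
    fix p :: "real^'n^'n" assume p: "p \<in> SL"
    define i where "i = matrix_inv p"
    have ip: "p ** (i ** A) = A" "i ** (p ** A) = A" for A :: "real^'n^'n"
      using p by (simp_all add: i_def matrix_mul_assoc)
    define U where "U = {A. diag_cofactor k (i ** A) \<noteq> 0}"
    define V where "V = {A::real^'n^'n. diag_cofactor k A \<noteq> 0}"
    have smooth_i: "smooth_on_open UNIV (\<lambda>A. i ** A)"
      by (intro smooth_on_open_bounded_linear matrix_mult.bounded_linear_right open_UNIV)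
    have smooth_id: "smooth_on_open U (\<lambda>A::real^'n^'n. A)" if "open U" for U
      by (intro smooth_on_open_bounded_linear bounded_linear_ident that)
    have open_nonzero: "open {x. F x \<noteq> 0}" if "smooth_on_open UNIV F" for F :: "real^'n^'n \<Rightarrow> real"
    proof -
      have "C_k_on 0 UNIV F" using that unfolding smooth_on_open_def by blast
      then show ?thesis by (intro open_Collect_neq) (simp_all add: continuous_on_const)
    qed
    have U: "open U" unfolding U_def by (intro open_nonzero smooth_on_open_diag_cofactor smooth_i)
    have V: "open V" unfolding V_def by (intro open_nonzero smooth_on_open_diag_cofactor smooth_id open_UNIV)
    have i_U: "smooth_on_open U (\<lambda>A. i ** A)"
      by (rule smooth_on_open_subset[OF smooth_i U]) simp
    have "smooth_on_open U (\<lambda>A. f (i ** A))"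
      unfolding f_def by (intro smooth_on_open_set_diag smooth_on_open_diff smooth_on_open_det
          smooth_on_open_entry smooth_on_open_const i_U U)
    moreover have "smooth_on_open V (\<lambda>B. p ** h B)"
      unfolding h_def
      by (intro smooth_on_open_linear_compose[OF matrix_mult.bounded_linear_right]
          smooth_on_open_set_diag smooth_on_open_mult smooth_on_open_add smooth_on_open_diff smooth_on_open_det
          smooth_on_open_entry smooth_on_open_inverse smooth_on_open_diag_cofactor smooth_on_open_const
          smooth_id V) (simp add: V_def)
    moreover have "homeomorphism U V (\<lambda>A. f (i ** A)) (\<lambda>B. p ** h B)"
      using calculation by (intro homeomorphism_smooth) (auto simp: U_def V_def ip cf ch hf fh)
    moreover have "p \<in> U"
      using p by (simp add: U_def i_def diag_cofactor_mat_1)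
    moreover have "(\<lambda>A. f (i ** A)) ` (SL \<inter> U) = S \<inter> V"
    proof (intro set_eqI iffI)
      fix B assume "B \<in> (\<lambda>A. f (i ** A)) ` (SL \<inter> U)"
      then obtain A where A: "A \<in> SL" "A \<in> U" "B = f (i ** A)" by blast
      then have "det (i ** A) = 1"
        using p by (metis SL_det SL_mult i_def matrix_inv_SL)
      with A show "B \<in> S \<inter> V" by (auto simp: S_def V_def U_def cf) (simp add: f_def)
    next
      fix B assume "B \<in> S \<inter> V"
      then have B: "B$k$k = 0" "diag_cofactor k B \<noteq> 0" by (auto simp: S_def V_def)
      have "p ** h B \<in> SL \<inter> U"
        using p B by (auto simp: SL_def det_mul det_h U_def ip ch)
      moreover have "B = f (i ** (p ** h B))" using B by (simp add: ip fh)
      ultimately show "B \<in> (\<lambda>A. f (i ** A)) ` (SL \<inter> U)" by blast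
    qed
    ultimately show "\<exists>U V \<phi> \<psi> S'. p \<in> U \<and> smooth_on_open U \<phi> \<and> smooth_on_open V \<psi> \<and>
        homeomorphism U V \<phi> \<psi> \<and> subspace (S' :: (real^'n^'n) set) \<and> dim S' = dim S \<and> \<phi> ` (SL \<inter> U) = S' \<inter> V"
      using S by blast
  qed
  then show ?thesis ..
qed

section \<open>The metric: constant index, nondegeneracy and smoothness\<close>

lemma negative_definite_image:
  fixes f h :: "'a::euclidean_space \<Rightarrow> 'a"
  assumes S: "subspace S" "S \<subseteq> T" "\<forall>x\<in>S. x \<noteq> 0 \<longrightarrow> b x x < (0::real)"
    and f: "linear f" "\<And>x. h (f x) = x"
    and T: "\<And>x. x \<in> T \<Longrightarrow> f x \<in> T' \<and> b' (f x) (f x) = b x x"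
  shows "\<exists>S'. dim S = dim S' \<and> subspace S' \<and> S' \<subseteq> T' \<and> (\<forall>x\<in>S'. x \<noteq> 0 \<longrightarrow> b' x x < 0)"
proof (intro exI conjI)
  have "inj f" using f(2) by (metis injI)
  then show "dim S = dim (f ` S)" using dim_image_eq[OF f(1)] by (simp add: inj_on_subset)
  show "\<forall>x\<in>f ` S. x \<noteq> 0 \<longrightarrow> b' x x < 0"
    using S T linear_0[OF f(1)] by (metis imageE subsetD)
  show "subspace (f ` S)" by (rule linear_subspace_image[OF f(1) S(1)])
  show "f ` S \<subseteq> T'" using S(2) T by blast
qed

text \<open>A linear isometry and its inverse carry negative definite subspaces to negative definite
  subspaces of equal dimension. The two sets under \<open>Max\<close> therefore coincide, and the
  indices agree without being computed.\<close>

lemma index_form_linear_isomorphism: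
  fixes f h :: "'a::euclidean_space \<Rightarrow> 'a"
  assumes f: "linear f" "linear h" "\<And>x. h (f x) = x" "\<And>x. f (h x) = x"
    and T: "\<And>x. f x \<in> T' \<longleftrightarrow> x \<in> T" and b: "\<And>x. x \<in> T \<Longrightarrow> b' (f x) (f x) = b x x"
  shows "index_form T' b' = index_form T b"
proof -
  have T': "h x \<in> T \<and> b (h x) (h x) = b' x x" if "x \<in> T'" for x
    using T[of "h x"] b[of "h x"] f(4) that by simp
  have "{dim S |S. subspace S \<and> S \<subseteq> T' \<and> (\<forall>x\<in>S. x \<noteq> 0 \<longrightarrow> b' x x < 0)} =
      {dim S |S. subspace S \<and> S \<subseteq> T \<and> (\<forall>x\<in>S. x \<noteq> 0 \<longrightarrow> b x x < 0)}"
  proof (intro set_eqI iffI; elim CollectE exE conjE)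
    fix d S assume "d = dim S" "subspace S" "S \<subseteq> T'" "\<forall>x\<in>S. x \<noteq> 0 \<longrightarrow> b' x x < 0"
    then show "d \<in> {dim S |S. subspace S \<and> S \<subseteq> T \<and> (\<forall>x\<in>S. x \<noteq> 0 \<longrightarrow> b x x < 0)}"
      using negative_definite_image[of S T' b' h f T b] f T' by simp
  next
    fix d S assume "d = dim S" "subspace S" "S \<subseteq> T" "\<forall>x\<in>S. x \<noteq> 0 \<longrightarrow> b x x < 0"
    then show "d \<in> {dim S |S. subspace S \<and> S \<subseteq> T' \<and> (\<forall>x\<in>S. x \<noteq> 0 \<longrightarrow> b' x x < 0)}"
      using negative_definite_image[of S T b f h T' b'] f T b by simp
  qed
  then show ?thesis by (simp add: index_form_def)
qed

lemma matrix_inv_mat_1: "matrix_inv (mat 1) = (mat 1 :: real^'n^'n)"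
  by (rule matrix_inv_unique) simp

text \<open>The trace form is indefinite in general, so \<open>x\<close> is tested not against
  itself but against \<open>p ** transpose a\<close>. This vector is tangent since transposition
  keeps the trace, and the pairing is the squared Euclidean norm of \<open>a\<close>.\<close>

lemma SL_metric_nondegenerate:
  assumes p: "p \<in> (SL :: (real^'n^'n) set)" and x: "x \<in> tangent_space SL p"
    and zero: "\<And>y. y \<in> tangent_space SL p \<Longrightarrow> SL_metric p x y = 0"
  shows "x = 0"
proof -
  define a where "a = matrix_inv p ** x"
  have "trace a = 0" using x p by (simp add: a_def tangent_space_SL)
  then have "trace (transpose a) = 0" by (simp add: trace_def transpose_def)
  then have "p ** transpose a \<in> tangent_space SL p"
    using p by (simp add: tangent_space_SL matrix_mul_assoc)
  then have "trace (a ** transpose a) = 0"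
    using zero p by (fastforce simp: SL_metric_def a_def matrix_mul_assoc)
  then have "transpose a = 0" by (simp add: trace_mult_transpose)
  then have "a = 0" by (simp add: vec_eq_iff transpose_def)
  then have "p ** a = 0" by simp
  then show ?thesis using p by (simp add: a_def matrix_mul_assoc)
qed

lemma SL_metric_sym: "SL_metric p x y = SL_metric p y x"
  unfolding SL_metric_def by (metis matrix_mul_assoc trace_mul_sym)

lemma SL_metric_add_left: "SL_metric p (x + y) z = SL_metric p x z + SL_metric p y z"
  and SL_metric_scaleR_left: "SL_metric p (c *\<^sub>R x) z = c * SL_metric p x z"
  by (simp_all add: SL_metric_def matrix_mult.add_left matrix_mult.add_right matrix_mult.scaleR_left
      matrix_mult.scaleR_right trace_add trace_scaleR)

lemma SL_nondegenerate_symmetric_form: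
  "p \<in> SL \<Longrightarrow> nondegenerate_symmetric_form (tangent_space SL p) (SL_metric p)"
  unfolding nondegenerate_symmetric_form_def
  using SL_metric_nondegenerate[of p] SL_metric_sym[of p]
  by (simp add: SL_metric_add_left SL_metric_scaleR_left)

lemmas smooth_on_matrix_mult = smooth_on_bilinear[OF bounded_bilinear_matrix_mult]

text \<open>Left multiplication by \<open>p\<close> is a linear isometry from the tangent space at
  \<open>mat 1\<close> onto the one at \<open>p\<close>, so the index is the same
  everywhere.\<close>

lemma semi_riemannian_SL: "semi_riemannian_manifold (SL :: (real^'n^'n) set) SL_metric"
proof -
  have "index_form (tangent_space SL p) (SL_metric p) =
      index_form (tangent_space SL (mat 1 :: real^'n^'n)) (SL_metric (mat 1))" if p: "p \<in> SL" for p :: "real^'n^'n"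
    by (rule index_form_linear_isomorphism[where f = "\<lambda>x. p ** x" and h = "\<lambda>x. matrix_inv p ** x"])
      (use p in \<open>auto simp: tangent_space_SL tangent_space_SL[OF mat_1_SL] SL_metric_def matrix_mul_assoc matrix_inv_mat_1
        intro!: bounded_linear.linear matrix_mult.bounded_linear_right\<close>)
  moreover have "smooth_on SL (\<lambda>p. SL_metric p (X p) (Y p))"
    if "vector_field SL X" "vector_field SL Y" for X Y :: "real^'n^'n \<Rightarrow> real^'n^'n"
    unfolding SL_metric_def
    by (intro smooth_on_linear_compose[OF bounded_linear_trace] smooth_on_matrix_mult
        smooth_on_matrix_inv vector_field_smooth that)
  ultimately show ?thesis
    unfolding semi_riemannian_manifold_def semi_riemannian_metric_def
    using embedded_submanifold_SL SL_nondegenerate_symmetric_form by blast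
qed

section \<open>Connection and curvature of the special linear group\<close>

lemma tangent_space_SL_trace: "p \<in> SL \<Longrightarrow> v \<in> tangent_space SL p \<Longrightarrow> trace (matrix_inv p ** v) = 0"
  by (simp add: tangent_space_SL)

lemma left_translated_tangent: "p \<in> SL \<Longrightarrow> trace a = 0 \<Longrightarrow> p ** a \<in> tangent_space SL p"
  by (simp add: tangent_space_SL matrix_mul_assoc)

lemma left_invariant_vector_field:
  fixes a :: "real^'n^'n"
  assumes "trace a = 0"
  shows "vector_field SL (\<lambda>q. q ** a)"
  unfolding vector_field_def
  using assms by (simp add: smooth_on_bounded_linear matrix_mult.bounded_linear_left left_translated_tangent)

text \<open>Left-invariant fields serve as the extensions. They feed the assumption
  \<open>ext\<close> of \<open>levi_civita_unique\<close> and single out the value in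
  \<open>curvature_at\<close>.\<close>

lemma tangent_vector_extension:
  assumes "p \<in> SL" "z \<in> tangent_space SL p"
  shows "\<exists>Z. vector_field SL Z \<and> Z p = z"
  using assms left_invariant_vector_field[of "matrix_inv p ** z"]
  by (intro exI[of _ "\<lambda>q. q ** (matrix_inv p ** z)"]) (simp add: tangent_space_SL matrix_mul_assoc)

lemmas deriv_along_matrix_mult = deriv_along_bilinear[OF bounded_bilinear_matrix_mult]

lemmas matrix_ring_simps = matrix_mul_assoc matrix_mult.add_left matrix_mult.add_right
  matrix_mult.diff_left matrix_mult.diff_right matrix_mult.minus_left matrix_mult.minus_right
  matrix_mult.scaleR_left matrix_mult.scaleR_right

text \<open>Obtained by differentiating \<open>matrix_inv q ** q\<close>, which is constant along
  \<open>SL\<close>.\<close>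

lemma deriv_along_matrix_inv:
  assumes p: "p \<in> (SL :: (real^'n^'n) set)" and v: "v \<in> tangent_space SL p"
  shows "deriv_along SL matrix_inv p v = - (matrix_inv p ** v ** matrix_inv p)"
proof -
  let ?D = "deriv_along SL matrix_inv p v"
  have "deriv_along SL (\<lambda>q::real^'n^'n. matrix_inv q ** q) p v = matrix_inv p ** v + ?D ** p"
    using deriv_along_matrix_mult[OF smooth_on_matrix_inv smooth_on_bounded_linear[OF bounded_linear_ident] p v]
      deriv_along_bounded_linear[OF bounded_linear_ident v] by simp
  moreover have "deriv_along SL (\<lambda>q::real^'n^'n. matrix_inv q ** q) p = deriv_along SL (\<lambda>q. mat 1) p"
    using p by (intro deriv_along_cong) simp_all
  ultimately have "matrix_inv p ** v + ?D ** p = 0"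
    using deriv_along_const[OF v, of "mat 1 :: real^'n^'n"] by simp
  then have "(matrix_inv p ** v + ?D ** p) ** matrix_inv p = 0" by simp
  then show ?thesis
    using p by (simp add: matrix_ring_simps eq_neg_iff_add_eq_0 add.commute)
qed

text \<open>Differentiating the tangency condition of \<open>Y\<close> measures how far
  \<open>dY(v)\<close> is from being tangent. For \<open>v = X p\<close> the correction in
  \<open>SL_connection\<close> has exactly this trace after left translation, so subtracting it
  restores tangency.\<close>

lemma trace_deriv_along_vector_field:
  assumes p: "p \<in> (SL :: (real^'n^'n) set)" and v: "v \<in> tangent_space SL p" and Y: "vector_field SL Y"
  shows "trace (matrix_inv p ** deriv_along SL Y p v) = trace (matrix_inv p ** v ** matrix_inv p ** Y p)"
proof -
  note Y' = vector_field_smooth[OF Y]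
  have "deriv_along SL (\<lambda>q. trace (matrix_inv q ** Y q)) p = deriv_along SL (\<lambda>q. 0) p"
    using p vector_field_tangent[OF Y] by (intro deriv_along_cong) (simp_all add: tangent_space_SL)
  moreover have "deriv_along SL (\<lambda>q. trace (matrix_inv q ** Y q)) p v =
      trace (matrix_inv p ** deriv_along SL Y p v - matrix_inv p ** v ** matrix_inv p ** Y p)"
    using deriv_along_linear[OF bounded_linear_trace smooth_on_matrix_mult[OF smooth_on_matrix_inv Y'] p v]
      deriv_along_matrix_mult[OF smooth_on_matrix_inv Y' p v] deriv_along_matrix_inv[OF p v]
    by (simp add: matrix_ring_simps)
  ultimately show ?thesis using deriv_along_const[OF v, of "0::real"] by (simp add: trace_sub)
qed

text \<open>The Levi-Civita connection of the metric \<open>tr(A\<^sup>-\<^sup>1VA\<^sup>-\<^sup>1W)\<close> on all invertible matrices is given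
  by the same formula, and \<open>SL\<close> is totally geodesic for it.\<close>

definition SL_connection ::
    "(real^'n^'n \<Rightarrow> real^'n^'n) \<Rightarrow> (real^'n^'n \<Rightarrow> real^'n^'n) \<Rightarrow> real^'n^'n \<Rightarrow> real^'n^'n" where
  "SL_connection X Y p = deriv_along SL Y p (X p) -
     (1/2) *\<^sub>R (X p ** matrix_inv p ** Y p + Y p ** matrix_inv p ** X p)"

lemma SL_connection_vector_field:
  fixes X Y :: "real^'n^'n \<Rightarrow> real^'n^'n"
  assumes X: "vector_field SL X" and Y: "vector_field SL Y"
  shows "vector_field SL (SL_connection X Y)"
  unfolding vector_field_def
proof (intro conjI ballI)
  show "smooth_on SL (SL_connection X Y)"
    unfolding SL_connection_def
    by (intro smooth_on_diff smooth_on_scaleR smooth_on_const smooth_on_add smooth_on_matrix_mult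
        smooth_on_matrix_inv smooth_on_deriv_along vector_field_smooth X Y)
  fix p :: "real^'n^'n" assume p: "p \<in> SL"
  have "trace (matrix_inv p ** X p ** matrix_inv p ** Y p) = trace (matrix_inv p ** Y p ** matrix_inv p ** X p)"
    by (metis matrix_mul_assoc trace_mul_sym)
  then show "SL_connection X Y p \<in> tangent_space SL p"
    using p trace_deriv_along_vector_field[OF p vector_field_tangent[OF X p] Y]
    by (simp add: tangent_space_SL SL_connection_def matrix_ring_simps trace_sub trace_add trace_scaleR)
qed

text \<open>Each inverse in the metric contributes one negative term. The corrections of the two
  covariant derivatives give four half terms, which add up to the same two after a cyclic shift
  under the trace.\<close>

lemma SL_connection_metric:
  fixes X Y Z :: "real^'n^'n \<Rightarrow> real^'n^'n"
  assumes X: "vector_field SL X" and Y: "vector_field SL Y" and Z: "vector_field SL Z" and p: "p \<in> SL"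
  shows "deriv_along SL (\<lambda>q. SL_metric q (Y q) (Z q)) p (X p) =
    SL_metric p (SL_connection X Y p) (Z p) + SL_metric p (Y p) (SL_connection X Z p)"
proof -
  note v = vector_field_tangent[OF X p]
  define i where "i = matrix_inv p"
  define x where "x = X p"
  define y where "y = Y p"
  define z where "z = Z p"
  define dy where "dy = deriv_along SL Y p (X p)"
  define dz where "dz = deriv_along SL Z p (X p)"
  note defs = i_def x_def y_def z_def dy_def dz_def
  have s: "smooth_on SL Y" "smooth_on SL Z" "smooth_on SL (\<lambda>q. matrix_inv q ** Y q)"
    "smooth_on SL (\<lambda>q. matrix_inv q ** Y q ** matrix_inv q)"
    "smooth_on SL (\<lambda>q. matrix_inv q ** Y q ** matrix_inv q ** Z q)"
    by (intro smooth_on_matrix_mult smooth_on_matrix_inv vector_field_smooth[OF Y] vector_field_smooth[OF Z])+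
  have D: "deriv_along SL (\<lambda>q. SL_metric q (Y q) (Z q)) p (X p) =
      trace (i ** dy ** i ** z) + trace (i ** y ** i ** dz) -
      trace (i ** x ** i ** y ** i ** z) - trace (i ** y ** i ** x ** i ** z)"
    unfolding SL_metric_def deriv_along_linear[OF bounded_linear_trace s(5) p v]
      deriv_along_matrix_mult[OF s(4,2) p v] deriv_along_matrix_mult[OF s(3) smooth_on_matrix_inv p v]
      deriv_along_matrix_mult[OF smooth_on_matrix_inv s(1) p v] deriv_along_matrix_inv[OF p v]
    unfolding defs[symmetric] by (simp add: matrix_ring_simps trace_add trace_sub dy_def dz_def x_def)
  have "trace (i ** y ** i ** z ** i ** x) = trace (i ** x ** (i ** y ** i ** z))"
    by (subst trace_mul_sym[of "i ** x"]) (simp add: matrix_mul_assoc)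
  then have cyc: "trace (i ** y ** i ** z ** i ** x) = trace (i ** x ** i ** y ** i ** z)"
    by (simp add: matrix_mul_assoc)
  show ?thesis
    unfolding D unfolding SL_metric_def SL_connection_def dy_def dz_def
    unfolding i_def[symmetric] x_def[symmetric] y_def[symmetric] z_def[symmetric]
    by (simp add: matrix_ring_simps trace_add trace_sub trace_scaleR cyc field_simps)
qed

text \<open>The correction is symmetric and linear over functions in both arguments: it drops out of
  the torsion and leaves the Leibniz rule to \<open>deriv_along\<close>.\<close>

lemma SL_connection_levi_civita:
  "is_levi_civita (SL :: (real^'n^'n) set) SL_metric SL_connection"
  unfolding is_levi_civita_def affine_connection_def
proof (intro conjI allI impI ballI)
  fix X Y :: "real^'n^'n \<Rightarrow> real^'n^'n"
  assume "vector_field SL X" "vector_field SL Y"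
  then show "vector_field SL (SL_connection X Y)" by (rule SL_connection_vector_field)
next
  fix f h :: "real^'n^'n \<Rightarrow> real" and X X' Y :: "real^'n^'n \<Rightarrow> real^'n^'n" and p :: "real^'n^'n"
  assume *: "vector_field SL X" "vector_field SL X'" "vector_field SL Y" "p \<in> SL"
  have "linear (deriv_along SL Y p)"
    by (rule linear_deriv_along[OF vector_field_smooth[OF *(3)] *(4)])
  then show "SL_connection (\<lambda>q. f q *\<^sub>R X q + h q *\<^sub>R X' q) Y p =
      f p *\<^sub>R SL_connection X Y p + h p *\<^sub>R SL_connection X' Y p"
    by (simp add: SL_connection_def linear_add linear_cmul matrix_ring_simps algebra_simps)
next
  fix X Y Y' :: "real^'n^'n \<Rightarrow> real^'n^'n" and p :: "real^'n^'n"
  assume *: "vector_field SL X" "vector_field SL Y" "vector_field SL Y'" "p \<in> SL"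
  then show "SL_connection X (\<lambda>q. Y q + Y' q) p = SL_connection X Y p + SL_connection X Y' p"
    by (simp add: SL_connection_def deriv_along_add vector_field_smooth vector_field_tangent
        matrix_ring_simps algebra_simps)
next
  fix f :: "real^'n^'n \<Rightarrow> real" and X Y :: "real^'n^'n \<Rightarrow> real^'n^'n" and p :: "real^'n^'n"
  assume *: "smooth_on SL f" "vector_field SL X" "vector_field SL Y" "p \<in> SL"
  then show "SL_connection X (\<lambda>q. f q *\<^sub>R Y q) p = deriv_along SL f p (X p) *\<^sub>R Y p + f p *\<^sub>R SL_connection X Y p"
    by (simp add: SL_connection_def deriv_along_bilinear[OF bounded_bilinear_scaleR]
        vector_field_smooth vector_field_tangent matrix_ring_simps algebra_simps)
next
  fix X Y :: "real^'n^'n \<Rightarrow> real^'n^'n" and p :: "real^'n^'n"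
  show "SL_connection X Y p - SL_connection Y X p = lie_bracket SL X Y p"
    by (simp add: SL_connection_def lie_bracket_def algebra_simps)
next
  fix X Y Z :: "real^'n^'n \<Rightarrow> real^'n^'n" and p :: "real^'n^'n"
  assume "vector_field SL X" "vector_field SL Y" "vector_field SL Z" "p \<in> SL"
  then show "deriv_along SL (\<lambda>q. SL_metric q (Y q) (Z q)) p (X p) =
      SL_metric p (SL_connection X Y p) (Z p) + SL_metric p (Y p) (SL_connection X Z p)"
    by (rule SL_connection_metric)
qed

lemma is_levi_civita_SL:
  "is_levi_civita (SL :: (real^'n^'n) set) SL_metric (levi_civita SL SL_metric)"
  unfolding levi_civita_def by (rule someI[of "is_levi_civita SL SL_metric"]) (rule SL_connection_levi_civita)

lemma levi_civita_SL:
  assumes "vector_field SL X" "vector_field SL Y" "p \<in> SL"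
  shows "levi_civita SL SL_metric X Y p = SL_connection X Y p"
  by (rule levi_civita_unique[OF is_levi_civita_SL SL_connection_levi_civita assms
        SL_nondegenerate_symmetric_form subspace_tangent_space_SL tangent_vector_extension])
    (use assms in auto)

text \<open>The torsion identity is read backwards: the bracket is a difference of two values of
  \<open>SL_connection\<close>, which are already known to be vector fields.\<close>

lemma lie_bracket_SL_vector_field:
  assumes X: "vector_field SL X" and Y: "vector_field SL Y"
  shows "vector_field SL (lie_bracket SL X Y)"
proof -
  have eq: "lie_bracket SL X Y p = SL_connection X Y p - SL_connection Y X p" for p
    by (simp add: SL_connection_def lie_bracket_def algebra_simps)
  show ?thesis
    using SL_connection_vector_field[OF X Y] SL_connection_vector_field[OF Y X]
    by (auto simp: vector_field_def eq cong: smooth_on_cong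
        intro!: smooth_on_diff subspace_diff subspace_tangent_space_SL)
qed

section \<open>The curvature tensor of \<open>SL\<close>\<close>

lemma deriv_along_SL_connection:
  fixes X Y Z :: "real^'n^'n \<Rightarrow> real^'n^'n"
  assumes Y: "vector_field SL Y" and Z: "vector_field SL Z" and p: "p \<in> SL" and v: "v \<in> tangent_space SL p"
  defines "i \<equiv> matrix_inv p" and "D W \<equiv> deriv_along SL W p v"
  shows "deriv_along SL (SL_connection Y Z) p v = deriv_along SL (\<lambda>q. deriv_along SL Z q (Y q)) p v -
    (1/2) *\<^sub>R (D Y ** i ** Z p - Y p ** i ** v ** i ** Z p + Y p ** i ** D Z +
      D Z ** i ** Y p - Z p ** i ** v ** i ** Y p + Z p ** i ** D Y)"
proof -
  \<comment> \<open>Product rule for the correction, with the derivative of the inverse in the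
    middle. The iterated derivative of \<open>Z\<close> is left as it stands, to be treated by
    \<open>deriv_along_commutator\<close>.\<close>
  have product: "deriv_along SL (\<lambda>q. Y q ** matrix_inv q ** Z q) p v =
      D Y ** i ** Z p - Y p ** i ** v ** i ** Z p + Y p ** i ** D Z"
    if "vector_field SL Y" "vector_field SL Z" for Y Z
  proof -
    note s = vector_field_smooth[OF that(1)] vector_field_smooth[OF that(2)]
    show ?thesis
      unfolding deriv_along_matrix_mult[OF smooth_on_matrix_mult[OF s(1) smooth_on_matrix_inv] s(2) p v]
        deriv_along_matrix_mult[OF s(1) smooth_on_matrix_inv p v] deriv_along_matrix_inv[OF p v]
      by (simp add: matrix_ring_simps i_def D_def)
  qed
  have s: "smooth_on SL (\<lambda>q. Y q ** matrix_inv q ** Z q)" "smooth_on SL (\<lambda>q. Z q ** matrix_inv q ** Y q)"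
    by (intro smooth_on_matrix_mult smooth_on_matrix_inv vector_field_smooth Y Z)+
  show ?thesis
    unfolding SL_connection_def
      deriv_along_diff[OF smooth_on_deriv_along[OF vector_field_smooth[OF Z] Y]
        smooth_on_scaleR[OF smooth_on_const smooth_on_add[OF s]] p v]
      deriv_along_linear[OF bounded_linear_scaleR_right smooth_on_add[OF s] p v]
      deriv_along_add[OF s p v] product[OF Y Z] product[OF Z Y]
    by simp
qed

text \<open>With \<open>a = p\<^sup>-\<^sup>1x\<close>, \<open>b = p\<^sup>-\<^sup>1y\<close>, \<open>c = p\<^sup>-\<^sup>1z\<close> this is \<open>\<onequarter> p[[a,b],c]\<close>.\<close>

definition SL_curvature :: "real^'n^'n \<Rightarrow> real^'n^'n \<Rightarrow> real^'n^'n \<Rightarrow> real^'n^'n \<Rightarrow> real^'n^'n" where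
  "SL_curvature p x y z = (let i = matrix_inv p in
     (1/4) *\<^sub>R (x ** i ** y ** i ** z - y ** i ** x ** i ** z - z ** i ** x ** i ** y + z ** i ** y ** i ** x))"

lemma curvature_SL:
  fixes X Y Z :: "real^'n^'n \<Rightarrow> real^'n^'n"
  assumes X: "vector_field SL X" and Y: "vector_field SL Y" and Z: "vector_field SL Z" and p: "p \<in> SL"
  shows "curvature SL SL_metric X Y Z p = SL_curvature p (X p) (Y p) (Z p)"
proof -
  let ?nab = "levi_civita SL SL_metric"
  note br = lie_bracket_SL_vector_field[OF X Y]
  \<comment> \<open>\<open>levi_civita\<close> is known to equal \<open>SL_connection\<close> only
    at points of \<open>SL\<close>; under the outer derivative this suffices by
    \<open>deriv_along_cong\<close>.\<close>
  have second: "?nab X (?nab Y Z) p = SL_connection X (SL_connection Y Z) p"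
    if X: "vector_field SL X" and Y: "vector_field SL Y" for X Y
  proof -
    have "deriv_along SL (?nab Y Z) p = deriv_along SL (SL_connection Y Z) p"
      by (rule deriv_along_cong[OF levi_civita_SL[OF Y Z] p])
    then show ?thesis
      using levi_civita_SL[OF X levi_civita_vector_field[OF is_levi_civita_SL Y Z] p] levi_civita_SL[OF Y Z p]
      by (simp add: SL_connection_def)
  qed
  have R: "curvature SL SL_metric X Y Z p = SL_connection (lie_bracket SL X Y) Z p -
      SL_connection X (SL_connection Y Z) p + SL_connection Y (SL_connection X Z) p"
    unfolding curvature_def Let_def second[OF X Y] second[OF Y X] levi_civita_SL[OF br Z p] ..
  have comm: "deriv_along SL (\<lambda>q. deriv_along SL Z q (Y q)) p (X p) -
      deriv_along SL (\<lambda>q. deriv_along SL Z q (X q)) p (Y p) = deriv_along SL Z p (lie_bracket SL X Y p)"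
    by (rule deriv_along_commutator[OF vector_field_smooth[OF Z] X Y p vector_field_tangent[OF br p]])
  \<comment> \<open>With these names the claim becomes an identity of noncommutative polynomials.
    The second derivatives cancel: through \<open>comm\<close> the bracket term contributes
    \<open>H1 - H2\<close>, the two iterated terms \<open>- H1 + H2\<close>.\<close>
  define i where "i = matrix_inv p"
  define H1 where "H1 = deriv_along SL (\<lambda>q. deriv_along SL Z q (Y q)) p (X p)"
  define H2 where "H2 = deriv_along SL (\<lambda>q. deriv_along SL Z q (X q)) p (Y p)"
  define yx where "yx = deriv_along SL Y p (X p)"
  define xy where "xy = deriv_along SL X p (Y p)"
  define zx where "zx = deriv_along SL Z p (X p)"
  define zy where "zy = deriv_along SL Z p (Y p)"
  define x where "x = X p"
  define y where "y = Y p"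
  define z where "z = Z p"
  note defs = i_def H1_def H2_def yx_def xy_def zx_def zy_def x_def y_def z_def
  have bracket: "lie_bracket SL X Y p = yx - xy"
    by (simp add: lie_bracket_def yx_def xy_def)
  have D1: "deriv_along SL (SL_connection Y Z) p x = H1 - (1/2) *\<^sub>R (yx ** i ** z - y ** i ** x ** i ** z +
      y ** i ** zx + zx ** i ** y - z ** i ** x ** i ** y + z ** i ** yx)"
    unfolding defs by (rule deriv_along_SL_connection[OF Y Z p vector_field_tangent[OF X p]])
  have D2: "deriv_along SL (SL_connection X Z) p y = H2 - (1/2) *\<^sub>R (xy ** i ** z - x ** i ** y ** i ** z +
      x ** i ** zy + zy ** i ** x - z ** i ** y ** i ** x + z ** i ** xy)"
    unfolding defs by (rule deriv_along_SL_connection[OF X Z p vector_field_tangent[OF Y p]])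
  have N1: "SL_connection Y Z p = zy - (1/2) *\<^sub>R (y ** i ** z + z ** i ** y)"
    and N2: "SL_connection X Z p = zx - (1/2) *\<^sub>R (x ** i ** z + z ** i ** x)"
    by (simp_all add: SL_connection_def defs)
  have A1: "SL_connection X (SL_connection Y Z) p = deriv_along SL (SL_connection Y Z) p x -
      (1/2) *\<^sub>R (x ** i ** SL_connection Y Z p + SL_connection Y Z p ** i ** x)"
    and A2: "SL_connection Y (SL_connection X Z) p = deriv_along SL (SL_connection X Z) p y -
      (1/2) *\<^sub>R (y ** i ** SL_connection X Z p + SL_connection X Z p ** i ** y)"
    and A3: "SL_connection (lie_bracket SL X Y) Z p = (H1 - H2) -
      (1/2) *\<^sub>R ((yx - xy) ** i ** z + z ** i ** (yx - xy))"
    using comm unfolding bracket[symmetric]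
    by (simp_all add: SL_connection_def[of _ "SL_connection _ _"] SL_connection_def[of _ Z] defs)
  show ?thesis
    unfolding R A1 A2 A3 D1 D2 N1 N2 SL_curvature_def Let_def
    unfolding defs(1,8-10)[symmetric]
    \<comment> \<open>Once products are expanded they act as atoms, and comparing entries leaves
      linear arithmetic over the reals.\<close>
    by (simp add: matrix_ring_simps) (simp add: vec_eq_iff field_simps)
qed

text \<open>By \<open>curvature_SL\<close> the fields enter only through their values at
  \<open>p\<close>, so all extensions give the same value; that extensions exist rules out any other
  \<open>r\<close>.\<close>

lemma curvature_at_SL:
  assumes p: "p \<in> SL" and T: "x \<in> tangent_space SL p" "y \<in> tangent_space SL p" "z \<in> tangent_space SL p"
  shows "curvature_at SL SL_metric p x y z = SL_curvature p x y z"
  unfolding curvature_at_def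
proof (rule the_equality)
  fix r assume r: "\<forall>X Y Z. vector_field SL X \<longrightarrow> vector_field SL Y \<longrightarrow> vector_field SL Z \<longrightarrow>
      X p = x \<longrightarrow> Y p = y \<longrightarrow> Z p = z \<longrightarrow> curvature SL SL_metric X Y Z p = r"
  obtain X Y Z where "vector_field SL X" "vector_field SL Y" "vector_field SL Z" "X p = x" "Y p = y" "Z p = z"
    using T tangent_vector_extension[OF p] by metis
  with r curvature_SL[OF _ _ _ p] show "r = SL_curvature p x y z" by metis
qed (auto simp: curvature_SL p)

text \<open>If \<open>L\<close> maps into the span of \<open>B\<close>, expanding \<open>L i\<close> in \<open>B\<close> and \<open>b \<in> B\<close> in the orthonormal basis
  identifies the two traces.\<close>

lemma sum_representation_eq_trace:
  fixes L :: "'a::euclidean_space \<Rightarrow> 'a"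
  assumes B: "independent B" and L: "linear L" "range L \<subseteq> span B"
  shows "(\<Sum>b\<in>B. representation B (L b) b) = (\<Sum>i\<in>Basis. L i \<bullet> i)"
proof -
  have fin: "finite B" using B independent_imp_finite by blast
  have LB: "L x \<in> span B" for x using L(2) by blast
  have "representation B (L b) b = (\<Sum>i\<in>Basis. (b \<bullet> i) * representation B (L i) b)" for b
  proof -
    have "L b = L (\<Sum>i\<in>Basis. (b \<bullet> i) *\<^sub>R i)" by (simp add: euclidean_representation)
    also have "\<dots> = (\<Sum>i\<in>Basis. (b \<bullet> i) *\<^sub>R L i)" by (simp add: linear_sum[OF L(1)] linear_cmul[OF L(1)])
    finally have "representation B (L b) b = representation B (\<Sum>i\<in>Basis. (b \<bullet> i) *\<^sub>R L i) b" by simp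
    also have "\<dots> = (\<Sum>i\<in>Basis. representation B ((b \<bullet> i) *\<^sub>R L i) b)"
      by (subst representation_sum[OF B]) (auto intro: span_scale LB)
    finally show ?thesis by (simp add: representation_scale[OF B LB])
  qed
  then have "(\<Sum>b\<in>B. representation B (L b) b) =
      (\<Sum>i\<in>Basis. \<Sum>b\<in>B. (b \<bullet> i) * representation B (L i) b)"
    by (simp add: sum.swap[of _ Basis])
  also have "\<dots> = (\<Sum>i\<in>Basis. (\<Sum>b\<in>B. representation B (L i) b *\<^sub>R b) \<bullet> i)"
    by (simp add: inner_sum_left mult.commute)
  also have "\<dots> = (\<Sum>i\<in>Basis. L i \<bullet> i)"
    by (simp add: sum_representation_eq[OF B LB fin])
  finally show ?thesis .
qed

lemma some_basis:
  fixes T :: "'a::euclidean_space set"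
  assumes "subspace T"
  defines "B \<equiv> SOME B. independent B \<and> span B = T"
  shows "independent B" "span B = T"
proof -
  have "\<exists>B. independent B \<and> span B = T"
    using basis_exists[of T] assms(1) by (metis span_subspace)
  from someI_ex[OF this] show "independent B" "span B = T" by (simp_all add: B_def)
qed

text \<open>Only values on \<open>T\<close> matter for \<open>L'\<close>, which suits
  \<open>curvature_at\<close>, whose values at non-tangent vectors are not controlled. A linear
  \<open>L\<close> with range in \<open>T\<close> induces zero on the quotient by \<open>T\<close>,
  so its trace on the whole space is that of its restriction.\<close>

lemma trace_on_eq:
  fixes L L' :: "'a::euclidean_space \<Rightarrow> 'a"
  assumes T: "subspace T" and L: "linear L" "range L \<subseteq> T" and eq: "\<And>x. x \<in> T \<Longrightarrow> L' x = L x"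
  shows "trace_on T L' = (\<Sum>i\<in>Basis. L i \<bullet> i)"
proof -
  define B where "B = (SOME B. independent B \<and> span B = T)"
  have B: "independent B" "span B = T"
    unfolding B_def by (rule some_basis[OF T])+
  have "trace_on T L' = (\<Sum>b\<in>B. representation B (L b) b)"
    unfolding trace_on_def Let_def B_def[symmetric]
    using eq B(2) by (intro sum.cong refl) (auto simp: span_base)
  then show ?thesis using sum_representation_eq_trace B L by metis
qed

lemma trace_on_scaleR:
  fixes T :: "'a::euclidean_space set"
  assumes T: "subspace T" and eq: "\<And>x. x \<in> T \<Longrightarrow> L x = c *\<^sub>R x"
  shows "trace_on T L = c * dim T"
proof -
  define B where "B = (SOME B. independent B \<and> span B = T)"
  have B: "independent B" "span B = T"
    unfolding B_def by (rule some_basis[OF T])+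
  have "trace_on T L = (\<Sum>b\<in>B. c)"
    unfolding trace_on_def Let_def B_def[symmetric]
  proof (intro sum.cong refl)
    fix b assume b: "b \<in> B"
    then have "L b = c *\<^sub>R b" using eq B(2) span_base by blast
    then show "representation B (L b) b = c"
      using b B(1) by (simp add: representation_scale representation_basis span_base)
  qed
  also have "\<dots> = c * card B" by simp
  also have "card B = dim T" using B dim_eq_card_independent by (metis dim_span)
  finally show ?thesis by simp
qed

lemma sum_matrix_Basis:
  "(\<Sum>b\<in>(Basis :: (real^'n^'m) set). f b) = (\<Sum>i\<in>UNIV. \<Sum>j\<in>UNIV. f (axis i (axis j 1)))"
proof -
  have "(\<Sum>b\<in>(Basis :: (real^'n^'m) set). f b) = (\<Sum>b\<in>(\<lambda>(i, j). axis i (axis j 1)) ` UNIV. f b)"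
    by (rule sum.cong) (auto simp: Basis_vec_def)
  also have "\<dots> = (\<Sum>(i, j)\<in>UNIV. f (axis i (axis j 1)))"
    by (subst sum.reindex) (auto simp: inj_on_def axis_eq_axis intro!: sum.cong)
  finally show ?thesis by (simp add: sum.cartesian_product)
qed

text \<open>The matrix unit with indices \<open>i\<close>, \<open>j\<close> contributes
  \<open>A$i$i * C$j$j\<close>, and the double sum of these factors.\<close>

lemma trace_sandwich:
  "(\<Sum>b\<in>Basis. (A ** b ** C) \<bullet> b) = trace A * trace (C :: real^'n^'n)"
proof -
  have entry: "(A ** axis i (axis j 1) ** C) \<bullet> axis i (axis j 1) = A$i$i * C$j$j" for i j
  proof -
    have AE: "(A ** axis i (axis j 1)) $ k $ l = (if l = j then A$k$i else 0)" for k l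
    proof -
      have "(A ** axis i (axis j 1)) $ k $ l = (\<Sum>m\<in>UNIV. A$k$m * axis i (axis j 1) $ m $ l)"
        by (simp add: matrix_matrix_mult_def)
      also have "\<dots> = (\<Sum>m\<in>UNIV. if m = i then (if l = j then A$k$i else 0) else 0)"
        by (rule sum.cong) (auto simp: axis_def)
      finally show ?thesis by simp
    qed
    have "(A ** axis i (axis j 1) ** C) $ i $ j = (\<Sum>m\<in>UNIV. (A ** axis i (axis j 1)) $ i $ m * C$m$j)"
      by (simp add: matrix_matrix_mult_def[of "A ** _"])
    also have "\<dots> = (\<Sum>m\<in>UNIV. if m = j then A$i$i * C$j$j else 0)"
      by (rule sum.cong) (auto simp: AE)
    finally have "(A ** axis i (axis j 1) ** C) $ i $ j = A$i$i * C$j$j" by simp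
    then show ?thesis by (simp add: inner_axis)
  qed
  show ?thesis by (simp add: sum_matrix_Basis entry trace_def sum_product)
qed

section \<open>Ricci and scalar curvature\<close>

lemma ricci_SL:
  fixes p x y :: "real^'n^'n"
  assumes p: "p \<in> SL" and x: "x \<in> tangent_space SL p" and y: "y \<in> tangent_space SL p"
  shows "ricci SL SL_metric p x y = - (real CARD('n) / 2) * SL_metric p x y"
proof -
  define i where "i = matrix_inv p"
  \<comment> \<open>The factors \<open>mat 1\<close> bring every term to the form
    \<open>u ** z ** v\<close> required by \<open>trace_sandwich\<close>; their traces are the
    origin of the factor \<open>n\<close>.\<close>
  define L where "L = (\<lambda>z. (1/4) *\<^sub>R (x ** i ** z ** (i ** y) - mat 1 ** z ** (i ** x ** i ** y) -
    y ** i ** x ** i ** z ** mat 1 + y ** i ** z ** (i ** x)))"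
  have "linear L"
    unfolding L_def by (rule linearI) (simp_all add: matrix_ring_simps algebra_simps)
  moreover have "range L \<subseteq> tangent_space SL p"
  proof -
    have "trace (i ** L z) = 0" for z
    proof -
      \<comment> \<open>After left translation \<open>L z\<close> is a multiple of a commutator, so
        cyclicity cancels its four terms in pairs, for every matrix \<open>z\<close>.\<close>
      have "trace (i ** x ** i ** z ** i ** y) = trace (i ** y ** i ** x ** i ** z)"
        "trace (i ** z ** i ** x ** i ** y) = trace (i ** y ** i ** z ** i ** x)"
        by (metis matrix_mul_assoc trace_mul_sym)+
      then show ?thesis
        by (simp add: L_def matrix_ring_simps trace_add trace_sub trace_scaleR)
    qed
    then show ?thesis using p by (auto simp: tangent_space_SL i_def)
  qed
  moreover have "curvature_at SL SL_metric p x z y = L z" if "z \<in> tangent_space SL p" for z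
    by (simp add: curvature_at_SL p x y that SL_curvature_def L_def i_def Let_def matrix_mul_assoc)
  ultimately have "ricci SL SL_metric p x y = (\<Sum>b\<in>Basis. L b \<bullet> b)"
    unfolding ricci_def by (rule trace_on_eq[OF subspace_tangent_space_SL[OF p]])
  also have "\<dots> = (1/4) * (trace (x ** i) * trace (i ** y) - trace (mat 1 :: real^'n^'n) * trace (i ** x ** i ** y) -
      trace (y ** i ** x ** i) * trace (mat 1 :: real^'n^'n) + trace (y ** i) * trace (i ** x))"
    unfolding L_def trace_sandwich[symmetric]
    by (simp only: inner_scaleR_left inner_add_left inner_diff_left sum.distrib sum_subtractf sum_distrib_left
        distrib_left right_diff_distrib)
  also have "trace (i ** x) = 0" using tangent_space_SL_trace[OF p x] by (simp add: i_def)
  also have "trace (i ** y) = 0" using tangent_space_SL_trace[OF p y] by (simp add: i_def)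
  also have "trace (y ** i ** x ** i) = trace (i ** x ** i ** y)"
    by (metis matrix_mul_assoc trace_mul_sym)
  finally have "ricci SL SL_metric p x y = - (real CARD('n) / 2) * trace (i ** x ** i ** y)"
    by (simp add: trace_I)
  then show ?thesis by (simp only: SL_metric_def i_def)
qed

lemma scalar_curvature_SL:
  fixes p :: "real^'n^'n"
  assumes p: "p \<in> SL"
  shows "scalar_curvature SL SL_metric p = - (real CARD('n) / 2) * real (CARD('n) * CARD('n) - 1)"
proof -
  let ?T = "tangent_space SL p" and ?c = "- (real CARD('n) / 2)"
  note T = subspace_tangent_space_SL[OF p]
  \<comment> \<open>Since the Ricci tensor is a multiple of the metric, the same multiple of
    \<open>x\<close> represents it, and nondegeneracy makes the representing vector unique. The
    scalar curvature is then this constant times the dimension.\<close>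
  have "(THE u. u \<in> ?T \<and> (\<forall>y\<in>?T. SL_metric p u y = ricci SL SL_metric p x y)) = ?c *\<^sub>R x"
    if x: "x \<in> ?T" for x
  proof (rule the_equality)
    show cx: "?c *\<^sub>R x \<in> ?T \<and> (\<forall>y\<in>?T. SL_metric p (?c *\<^sub>R x) y = ricci SL SL_metric p x y)"
      using x p T by (simp add: ricci_SL SL_metric_scaleR_left subspace_scale del: scaleR_minus_left)
    fix u assume u: "u \<in> ?T \<and> (\<forall>y\<in>?T. SL_metric p u y = ricci SL SL_metric p x y)"
    have "SL_metric p (u + (- 1) *\<^sub>R (?c *\<^sub>R x)) y = 0" if "y \<in> ?T" for y
      using u cx that by (simp only: SL_metric_add_left SL_metric_scaleR_left)
    moreover have "u + (- 1) *\<^sub>R (?c *\<^sub>R x) \<in> ?T"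
      using u cx T by (intro subspace_add[OF T] subspace_scale[OF T, of "_ *\<^sub>R _"]) blast+
    ultimately have "u + (- 1) *\<^sub>R (?c *\<^sub>R x) = 0"
      using SL_metric_nondegenerate[OF p] by blast
    then show "u = ?c *\<^sub>R x" by (simp add: eq_neg_iff_add_eq_0)
  qed
  then show ?thesis
    unfolding scalar_curvature_def metric_trace_def
    by (simp only: trace_on_scaleR[OF T, where c = ?c] dim_tangent_space_SL[OF p])
qed

theorem proposition4p3:
  fixes n :: real
  assumes n: "n = real CARD('n::finite)"
  shows "(\<forall>A \<in> (SL :: (real^'n^'n) set). tangent_space SL A = {W. trace (matrix_inv A ** W) = 0}) \<and>
    einstein_manifold (SL :: (real^'n^'n) set) SL_metric \<and>
    (\<forall>A \<in> (SL :: (real^'n^'n) set). \<forall>V \<in> tangent_space SL A. \<forall>W \<in> tangent_space SL A.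
       ricci SL SL_metric A V W = - (n / 2) * SL_metric A V W) \<and>
    (\<forall>A \<in> (SL :: (real^'n^'n) set).
       scalar_curvature SL SL_metric A = - ((n - 1) * n * (n + 1) / 2))"
proof (intro conjI ballI)
  show "tangent_space SL A = {W. trace (matrix_inv A ** W) = 0}" if "A \<in> SL" for A :: "real^'n^'n"
    by (rule tangent_space_SL[OF that])
  show "einstein_manifold (SL :: (real^'n^'n) set) SL_metric"
    unfolding einstein_manifold_def using semi_riemannian_SL ricci_SL by blast
  show "ricci SL SL_metric A V W = - (n / 2) * SL_metric A V W"
    if "A \<in> SL" "V \<in> tangent_space SL A" "W \<in> tangent_space SL A" for A V W :: "real^'n^'n"
    using ricci_SL[OF that] by (simp add: n)
  show "scalar_curvature SL SL_metric A = - ((n - 1) * n * (n + 1) / 2)" if "A \<in> SL" for A :: "real^'n^'n"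
  proof -
    \<comment> \<open>The dimension was stated with truncated subtraction of natural numbers; it is
      exact because an index type has at least one element.\<close>
    have "1 \<le> CARD('n) * CARD('n)" by (simp add: Suc_le_eq)
    then have "real (CARD('n) * CARD('n) - 1) = n * n - 1" by (simp add: n of_nat_diff)
    then show ?thesis by (simp add: scalar_curvature_SL[OF that] n[symmetric] algebra_simps)
  qed
qed

end
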